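(* There is an absolute constant $C>0$ such that for every $\varepsilon, \alpha > 0$ there exists $n_0$ such that the following holds for all integers $n \ge n_0$ and all positive integers $k < (1/2-\alpha)n$. If $\mathbf{L}$ is chosen uniformly at random from the set $\mathcal{L}_{k,n}$ of $k\times n$ Latin rectangles with symbol set $[n]$, then (a) the expected number of order-$3$ Latin subsquares of $\mathbf{L}$ lies between $(1-\varepsilon)\binom{k}{3}/(3n^3)$ and $(1+\varepsilon)\binom{k}{3}/(3n^3)$, and (b) the probability that $\mathbf{L}$ contains a Latin subsquare of order greater than $3$ is at most $C n^{-4}$.
   Context: $[n] = \{1,\dots,n\}$. For $k\le n$, a $k\times n$ Latin rectangle is a $k\times n$ array of $n$ symbols in which each row contains each symbol exactly once and each column contains each symbol at most once; $\mathcal{L}_{k,n}$ is the set of those with symbol set $[n]$. For $m<n$, an order-$m$ subsquare is an $m\times m$ array induced by choosing a set of $m$ rows and a set of $m$ columns (not necessarily consecutive); it is Latin if it is itself a Latin square, i.e. for some set of $m$ symbols each row and each column of the subsquare contains each of these symbols exactly once. *)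

theory Defs
  imports "HOL-Probability.Probability" "HOL-Number_Theory.Cong"
begin

(* The array entry in row i and column j is L i j; rows are indexed by {1..k}, columns by {1..n}.
   The extensional function space makes every array a single function, so that counting
   (and hence the uniform distribution) is over arrays. *)
definition latin_rectangles :: "nat \<Rightarrow> nat \<Rightarrow> (nat \<Rightarrow> nat \<Rightarrow> nat) set" where
  "latin_rectangles k n =
     {L \<in> {1..k} \<rightarrow>\<^sub>E ({1..n} \<rightarrow>\<^sub>E {1..n}).
        (\<forall>i\<in>{1..k}. \<forall>s\<in>{1..n}. \<exists>!j. j \<in> {1..n} \<and> L i j = s) \<and>
        (\<forall>j\<in>{1..n}. \<forall>s\<in>{1..n}. \<exists>\<^sub>\<le>\<^sub>1i. i \<in> {1..k} \<and> L i j = s)}"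

definition is_latin_subarray :: "(nat \<Rightarrow> nat \<Rightarrow> nat) \<Rightarrow> nat set \<Rightarrow> nat set \<Rightarrow> nat set \<Rightarrow> bool" where
  "is_latin_subarray L R Q S \<longleftrightarrow>
     (\<forall>i\<in>R. \<forall>s\<in>S. \<exists>!j. j \<in> Q \<and> L i j = s) \<and>
     (\<forall>j\<in>Q. \<forall>s\<in>S. \<exists>!i. i \<in> R \<and> L i j = s)"

(* A subsquare is identified with its set R of rows and its set Q of columns. *)
definition latin_subsquares ::
    "nat \<Rightarrow> nat \<Rightarrow> nat \<Rightarrow> (nat \<Rightarrow> nat \<Rightarrow> nat) \<Rightarrow> (nat set \<times> nat set) set" where
  "latin_subsquares m k n L =
     {(R, Q). m < n \<and> R \<subseteq> {1..k} \<and> card R = m \<and> Q \<subseteq> {1..n} \<and> card Q = m \<and>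
        (\<exists>S. S \<subseteq> {1..n} \<and> card S = m \<and> is_latin_subarray L R Q S)}"

lemma finite_latin_rectangles: "finite (latin_rectangles k n)"
  unfolding latin_rectangles_def
  by (intro finite_subset[OF Collect_restrict] finite_PiE finite_atLeastAtMost)

(* pmf_of_set is only meaningful on finite nonempty sets. *)
lemma latin_rectangles_nonempty:
  assumes "k \<le> n"
  shows "latin_rectangles k n \<noteq> {}"
proof -
  define f where "f i j = (i + j) mod n + 1" for i j :: nat
  define L where "L = restrict (\<lambda>i. restrict (f i) {1..n}) {1..k}"
  have L: "L i j = f i j" if "i \<in> {1..k}" "j \<in> {1..n}" for i j
    using that by (simp add: L_def)
  have range: "f i j \<in> {1..n}" if "j \<in> {1..n}" for i j
  proof -
    have "n > 0" using that by simp
    then show ?thesis by (simp add: f_def Suc_le_eq)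
  qed
  have eq: "a = b"
    if h: "(c + a) mod n = (c + b) mod n" and a: "a \<in> {1..n}" and b: "b \<in> {1..n}" for a b c :: nat
  proof -
    have ab: "a mod n = b mod n"
      using cong_add_lcancel_nat[of c a b n] h by (simp add: cong_def)
    show ?thesis
    proof (cases "a = n"; cases "b = n")
      assume "a = n" "b \<noteq> n" then show ?thesis using ab b by simp
    next
      assume "a \<noteq> n" "b = n" then show ?thesis using ab a by simp
    next
      assume "a \<noteq> n" "b \<noteq> n" then show ?thesis using ab a b by simp
    qed simp
  qed
  have row: "inj_on (f i) {1..n}" for i
  proof (rule inj_onI)
    fix a b assume ab: "a \<in> {1..n}" "b \<in> {1..n}" and "f i a = f i b"
    then have "(i + a) mod n = (i + b) mod n" by (simp add: f_def)
    then show "a = b" using ab by (rule eq)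
  qed
  have row_image: "f i ` {1..n} = {1..n}" for i
    by (rule endo_inj_surj[OF finite_atLeastAtMost image_subsetI[OF range] row])
  have rows: "\<exists>!j. j \<in> {1..n} \<and> L i j = s" if i: "i \<in> {1..k}" and s: "s \<in> {1..n}" for i s
  proof -
    obtain j where j: "j \<in> {1..n}" "s = f i j"
      using s row_image[of i] by blast
    show ?thesis
    proof (rule ex1I[of _ j])
      show "j \<in> {1..n} \<and> L i j = s"
        using j L[OF i j(1)] by simp
    next
      fix j' assume *: "j' \<in> {1..n} \<and> L i j' = s"
      have "f i j' = f i j" using * j(2) L[OF i, of j'] by simp
      then show "j' = j" using inj_onD[OF row] * j(1) by blast
    qed
  qed
  have columns: "\<exists>\<^sub>\<le>\<^sub>1i. i \<in> {1..k} \<and> L i j = s" if j: "j \<in> {1..n}" for j s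
  proof (rule Uniq_I)
    fix a b assume a: "a \<in> {1..k} \<and> L a j = s" and b: "b \<in> {1..k} \<and> L b j = s"
    have "f a j = f b j" using a b L[of a j] L[of b j] j by simp
    then have "(j + a) mod n = (j + b) mod n" by (simp add: f_def add.commute)
    then show "a = b"
      by (rule eq) (use a b assms in simp_all)
  qed
  have "L \<in> {1..k} \<rightarrow>\<^sub>E ({1..n} \<rightarrow>\<^sub>E {1..n})"
    unfolding L_def using range by (intro restrict_PiE_iff[THEN iffD2] ballI)
  then have "L \<in> latin_rectangles k n"
    unfolding latin_rectangles_def using rows columns by blast
  then show ?thesis by blast
qed

end

theory Submission
  imports Defs "HOL-Combinatorics.Cycles"
begin

text \<open>
  Everything follows from one estimate: if \<open>P\<close> is a sparse set of prescribed entries and \<open>(r, c, s)\<close> is a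
  further entry compatible with \<open>P\<close>, then a random rectangle that contains \<open>P\<close> has the symbol \<open>s\<close> at
  \<open>(r, c)\<close> with probability \<open>(1 \<plusminus> \<epsilon>) / n\<close>.  Multiplying over the entries of a block shows that a
  prescribed Latin block with \<open>e\<close> entries occurs with probability \<open>((1 \<plusminus> \<epsilon>) / n) ^ e\<close>.  Statement (a) is
  then linearity of expectation, since there are 12 Latin squares of order 3 on given symbols.  Statement
  (b) is a union bound (\<open>prob_large_subsquare\<close>), in which order 4 contributes the main term.

  The estimate is proved by switchings within row \<open>r\<close>.  Draw an arc from column \<open>j\<close> to column \<open>j'\<close> when
  the entry of row \<open>r\<close> in column \<open>j'\<close> does not occur elsewhere in column \<open>j\<close>.  This digraph is regular
  of degree \<open>d = n + 1 - k\<close> in both directions, and rotating row \<open>r\<close> along one of its cycles gives another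
  Latin rectangle.  Rotation along cycles of a fixed length \<open>l + 2\<close> through \<open>c\<close> matches the rectangles with
  \<open>s\<close> at \<open>(r, c)\<close> with those whose column \<open>c\<close> misses \<open>s\<close> (\<open>reroute_bij\<close>).  What makes this precise is
  that the number of cycles is almost independent of the rectangle: in a \<open>d\<close>-regular digraph on \<open>n\<close>
  vertices the number of walks with \<open>l + 1\<close> arcs between two vertices is \<open>d ^ (l + 1) / n\<close> up to an error
  at most \<open>(n - d) ^ l\<close> (\<open>card_walks_deviation\<close>).  For \<open>k < (1/2 - \<alpha>) n\<close> the quotient \<open>(n - d) / d\<close> is
  at most a constant smaller than 1, and a large constant \<open>l\<close> makes the relative error as small as
  desired, uniformly over all rectangles.

  So having \<open>s\<close> at \<open>(r, c)\<close> is \<open>1 / d\<close> times as likely as having no \<open>s\<close> in column \<open>c\<close>, up to a factor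
  \<open>1 \<plusminus> \<epsilon>\<close>.  The same comparison in the other rows determines the probability that column \<open>c\<close> misses
  \<open>s\<close>: it is about \<open>d / n\<close>, because the \<open>k\<close> rows and this event exhaust all cases.  This gives the
  probability \<open>1 / n\<close> (\<open>card_extensions_insert\<close>).
\<close>

section \<open>Walks in regular digraphs\<close>

text \<open>
  The list holds only the interior vertices, so a member of \<open>walks V E l u v\<close> has \<open>l + 1\<close> arcs, and the
  case \<open>l = 0\<close> is a single arc from \<open>u\<close> to \<open>v\<close>.
\<close>

definition walks :: "'a set \<Rightarrow> ('a \<Rightarrow> 'a \<Rightarrow> bool) \<Rightarrow> nat \<Rightarrow> 'a \<Rightarrow> 'a \<Rightarrow> 'a list set" where
  "walks V E l u v =
     {xs. length xs = l \<and> set xs \<subseteq> V \<and> successively E (u # xs @ [v])}"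

definition regular_digraph :: "'a set \<Rightarrow> ('a \<Rightarrow> 'a \<Rightarrow> bool) \<Rightarrow> nat \<Rightarrow> bool" where
  "regular_digraph V E d \<longleftrightarrow> finite V \<and>
     (\<forall>u\<in>V. card {x\<in>V. E u x} = d) \<and> (\<forall>v\<in>V. card {x\<in>V. E x v} = d)"

lemma regular_digraph_conversep:
  "regular_digraph V E d \<Longrightarrow> regular_digraph V (\<lambda>x y. E y x) d"
  by (simp add: regular_digraph_def)

lemma finite_walks: "finite V \<Longrightarrow> finite (walks V E l u v)"
  unfolding walks_def
  by (rule finite_subset[OF _ finite_lists_length_eq[of V l]]) auto

lemma card_walks_0: "card (walks V E 0 u v) = (if E u v then 1 else 0)"
proof -
  have "walks V E 0 u v = (if E u v then {[]} else {})"
    by (auto simp: walks_def)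
  then show ?thesis by simp
qed

lemma card_walks_Suc:
  assumes "finite V"
  shows "card (walks V E (Suc l) u v) = (\<Sum>x\<in>{x\<in>V. E u x}. card (walks V E l x v))"
proof -
  have "walks V E (Suc l) u v = (\<Union>x\<in>{x\<in>V. E u x}. (#) x ` walks V E l x v)"
    by (auto simp: walks_def length_Suc_conv image_iff)
  also have "card \<dots> = (\<Sum>x\<in>{x\<in>V. E u x}. card ((#) x ` walks V E l x v))"
    using assms by (intro card_UN_disjoint) (auto simp: finite_walks)
  finally show ?thesis by (simp add: card_image)
qed

lemma sum_card_walks:
  assumes "regular_digraph V E d" "v \<in> V"
  shows "(\<Sum>u\<in>V. card (walks V E l u v)) = d ^ Suc l"
proof (induction l)
  case 0
  have "(\<Sum>u\<in>V. card (walks V E 0 u v)) = card {u\<in>V. E u v}"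
    using assms by (simp add: card_walks_0 regular_digraph_def flip: sum.inter_filter)
  then show ?case using assms by (simp add: regular_digraph_def)
next
  case (Suc l)
  have fin: "finite V" using assms by (simp add: regular_digraph_def)
  have "(\<Sum>u\<in>V. card (walks V E (Suc l) u v))
      = (\<Sum>x\<in>V. \<Sum>u\<in>{u\<in>V. E u x}. card (walks V E l x v))"
    unfolding card_walks_Suc[OF fin] by (rule sum.swap_restrict) (rule fin)+
  also have "\<dots> = (\<Sum>x\<in>V. d * card (walks V E l x v))"
    using assms(1) by (intro sum.cong) (auto simp: regular_digraph_def)
  finally show ?case by (simp add: Suc flip: sum_distrib_left)
qed

text \<open>
  By \<open>sum_card_walks\<close>, splitting off the first arc expresses the number of longer walks from \<open>u\<close> as the
  total \<open>d ^ Suc l\<close> minus the number of shorter walks from the non-neighbours of \<open>u\<close>.  Hence the deviation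
  from the average is minus a sum of \<open>card V - d\<close> shorter deviations: it grows by at most the factor
  \<open>card V - d\<close> per step, while the average grows by the factor \<open>d\<close>.  Once \<open>d\<close> exceeds half of the
  vertices, walks of large constant length are almost equidistributed.
\<close>

lemma card_walks_deviation:
  assumes "regular_digraph V E d" "u \<in> V" "v \<in> V"
  shows "\<bar>real (card (walks V E l u v)) - real d ^ Suc l / card V\<bar> \<le> (real (card V) - d) ^ l"
  using assms(2)
proof (induction l arbitrary: u)
  case 0
  have fin: "finite V" using assms by (simp add: regular_digraph_def)
  have "d = card {x\<in>V. E u x}" using assms 0 by (simp add: regular_digraph_def)
  also have "\<dots> \<le> card V" by (rule card_mono) (use fin in auto)
  finally have "real d / card V \<le> 1" by (simp add: divide_le_eq)
  moreover have "0 \<le> real d / card V" by simp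
  ultimately have "\<bar>real (if E u v then 1 else 0) - real d / card V\<bar> \<le> 1"
    by (cases "E u v") (simp_all only: if_True if_False abs_le_iff, linarith+)
  then show ?case by (simp only: card_walks_0 power_0 power_one_right power_Suc0_right)
next
  case (Suc l)
  have fin: "finite V" using assms by (simp add: regular_digraph_def)
  have n: "card V > 0" using fin assms(3) by (auto simp: card_gt_0_iff)
  let ?N = "{x\<in>V. E u x}" and ?M = "{x\<in>V. \<not> E u x}"
  let ?w = "\<lambda>x. real (card (walks V E l x v))"
  have cN: "card ?N = d" using assms Suc by (simp add: regular_digraph_def)
  have split: "?N \<union> ?M = V" "?N \<inter> ?M = {}" by auto
  have cNM: "card ?N + card ?M = card V"
    using card_Un_disjoint[of ?N ?M] fin split by simp
  have cM: "real (card ?M) = real (card V) - d" using cNM cN by linarith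
  have "(\<Sum>x\<in>?N. ?w x) + (\<Sum>x\<in>?M. ?w x) = (\<Sum>x\<in>V. ?w x)"
    using sum.union_disjoint[of ?N ?M ?w] fin split by simp
  also have "\<dots> = real d ^ Suc l"
    using sum_card_walks[OF assms(1,3), of l] by (metis of_nat_power of_nat_sum)
  finally have "(\<Sum>x\<in>?N. ?w x) = real d ^ Suc l - (\<Sum>x\<in>?M. ?w x)" by simp
  then have "real (card (walks V E (Suc l) u v)) = real d ^ Suc l - (\<Sum>x\<in>?M. ?w x)"
    by (simp add: card_walks_Suc[OF fin])
  moreover have "real d ^ Suc l = real d ^ Suc (Suc l) / card V + card ?M * (real d ^ Suc l / card V)"
    unfolding cM using n by (simp add: field_simps)
  moreover have "(\<Sum>x\<in>?M. ?w x - real d ^ Suc l / card V)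
      = (\<Sum>x\<in>?M. ?w x) - card ?M * (real d ^ Suc l / card V)"
    by (simp add: sum_subtractf)
  ultimately have "real (card (walks V E (Suc l) u v)) - real d ^ Suc (Suc l) / card V
      = - (\<Sum>x\<in>?M. ?w x - real d ^ Suc l / card V)" by linarith
  then have "\<bar>real (card (walks V E (Suc l) u v)) - real d ^ Suc (Suc l) / card V\<bar>
      = \<bar>\<Sum>x\<in>?M. ?w x - real d ^ Suc l / card V\<bar>" by simp
  also have "\<dots> \<le> (\<Sum>x\<in>?M. (real (card V) - d) ^ l)"
    by (rule order_trans[OF sum_abs sum_mono]) (use Suc.IH in auto)
  also have "\<dots> = (real (card V) - d) ^ Suc l" by (simp add: cM)
  finally show ?case .
qed

text \<open>
  A random list fails to be distinct and disjoint from \<open>F\<close> with probability \<open>O(1 / card V)\<close>, because each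
  new entry has at most \<open>card F + l\<close> forbidden values.  The factor \<open>card V\<close> on the left replaces an exponent
  \<open>l - 1\<close> on the right.
\<close>

lemma card_non_distinct_lists:
  assumes "finite V" "finite F"
  shows "card V * card {xs. length xs = l \<and> set xs \<subseteq> V \<and> \<not> (distinct xs \<and> set xs \<inter> F = {})}
      \<le> l * (card F + l) * card V ^ l"
proof (induction l)
  case 0
  then show ?case by simp
next
  case (Suc l)
  let ?n = "card V"
  let ?B = "\<lambda>l. {xs. length xs = l \<and> set xs \<subseteq> V \<and> \<not> (distinct xs \<and> set xs \<inter> F = {})}"
  let ?A = "{xs. set xs \<subseteq> V \<and> length xs = l}"
  have finA: "finite ?A" and cA: "card ?A = ?n ^ l"
    using finite_lists_length_eq[OF assms(1)] card_lists_length_eq[OF assms(1)] by auto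
  have finB: "finite (?B l)" by (rule finite_subset[OF _ finA]) auto
  have "?B (Suc l) \<subseteq> (\<lambda>(x, xs). x # xs) ` (V \<times> ?B l)
          \<union> (\<lambda>(xs, x). x # xs) ` Sigma ?A (\<lambda>xs. F \<union> set xs)"
    by (auto simp: length_Suc_conv image_iff)
  then have "card (?B (Suc l)) \<le> card ((\<lambda>(x, xs). x # xs) ` (V \<times> ?B l)
          \<union> (\<lambda>(xs, x). x # xs) ` Sigma ?A (\<lambda>xs. F \<union> set xs))"
    by (intro card_mono) (use assms finB finA in auto)
  also have "\<dots> \<le> card ((\<lambda>(x, xs). x # xs) ` (V \<times> ?B l))
      + card ((\<lambda>(xs, x). x # xs) ` Sigma ?A (\<lambda>xs. F \<union> set xs))"
    by (rule card_Un_le)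
  also have "\<dots> \<le> card (V \<times> ?B l) + card (Sigma ?A (\<lambda>xs. F \<union> set xs))"
    by (intro add_mono card_image_le) (use assms finB finA in auto)
  also have "card (V \<times> ?B l) = ?n * card (?B l)" by (simp add: card_cartesian_product)
  also have "card (Sigma ?A (\<lambda>xs. F \<union> set xs)) = (\<Sum>xs\<in>?A. card (F \<union> set xs))"
    by (rule card_SigmaI) (use assms finA in auto)
  also have "\<dots> \<le> (\<Sum>xs\<in>?A. card F + l)"
  proof (rule sum_mono)
    fix xs assume "xs \<in> ?A"
    then have "card (set xs) \<le> l" using card_length[of xs] by simp
    then show "card (F \<union> set xs) \<le> card F + l" using card_Un_le[of F "set xs"] by linarith
  qed
  also have "\<dots> = ?n ^ l * (card F + l)" by (simp add: cA)
  finally have "?n * card (?B (Suc l)) \<le> ?n * (?n * card (?B l) + ?n ^ l * (card F + l))"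
    by simp
  also have "\<dots> \<le> ?n * (l * (card F + l) * ?n ^ l + ?n ^ l * (card F + l))"
    using Suc by simp
  also have "\<dots> = Suc l * (card F + l) * ?n ^ Suc l" by (simp add: algebra_simps)
  also have "\<dots> \<le> Suc l * (card F + Suc l) * ?n ^ Suc l" by (intro mult_mono) auto
  finally show ?case .
qed

definition proper_walks ::
    "'a set \<Rightarrow> ('a \<Rightarrow> 'a \<Rightarrow> bool) \<Rightarrow> 'a set \<Rightarrow> nat \<Rightarrow> 'a \<Rightarrow> 'a \<Rightarrow> 'a list set" where
  "proper_walks V E F l u v = {xs\<in>walks V E l u v. distinct xs \<and> set xs \<inter> F = {}}"

text \<open>
  Two errors are added here, both relative to the main term \<open>d ^ Suc l / card V\<close>: the failure of
  equidistribution, which decays geometrically in \<open>l\<close>, and the improper walks, a small fraction when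
  \<open>card F\<close> and \<open>l\<close> are much smaller than \<open>card V / (l * 2 ^ l)\<close>.
\<close>

lemma card_proper_walks:
  fixes \<eta> :: real
  assumes reg: "regular_digraph V E d" and uv: "u \<in> V" "v \<in> V" and "finite F"
    and half: "card V \<le> 2 * d"
    and eta1: "2 * ((real (card V) - d) / d) ^ l \<le> \<eta> / 2"
    and eta2: "2 ^ Suc l * (l * (card F + l)) \<le> \<eta> / 2 * card V"
  shows "\<bar>real (card (proper_walks V E F l u v)) - real d ^ Suc l / card V\<bar>
      \<le> \<eta> * (real d ^ Suc l / card V)"
proof -
  let ?n = "real (card V)"
  let ?B = "{xs. length xs = l \<and> set xs \<subseteq> V \<and> \<not> (distinct xs \<and> set xs \<inter> F = {})}"
  have fin: "finite V" using reg by (simp add: regular_digraph_def)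
  have n: "?n > 0" using fin uv(1) by (auto simp: card_gt_0_iff)
  then have d: "real d > 0" using half by simp
  have half': "?n \<le> 2 * real d" using half by linarith
  have "finite ?B" by (rule finite_subset[OF _ finite_lists_length_eq[OF fin, of l]]) auto
  then have "card (walks V E l u v) \<le> card (proper_walks V E F l u v \<union> ?B)"
    by (intro card_mono) (auto simp: proper_walks_def finite_walks[OF fin], auto simp: walks_def)
  then have up: "card (walks V E l u v) \<le> card (proper_walks V E F l u v) + card ?B"
    using card_Un_le order_trans by blast
  have lo: "card (proper_walks V E F l u v) \<le> card (walks V E l u v)"
    by (intro card_mono finite_walks[OF fin]) (auto simp: proper_walks_def)
  have "?n * real (card ?B) \<le> l * (card F + l) * ?n ^ l"
    using card_non_distinct_lists[OF fin \<open>finite F\<close>, of l]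
    by (simp only: flip: of_nat_mult of_nat_power)
  also have "\<dots> \<le> l * (card F + l) * (2 * real d) ^ l"
    by (intro mult_left_mono power_mono half') auto
  finally have "2 * real d * (?n * real (card ?B))
      \<le> 2 * real d * (l * (card F + l) * (2 * real d) ^ l)"
    using d by simp
  also have "\<dots> = (2 ^ Suc l * (l * (card F + l))) * real d ^ Suc l"
    by (simp add: power_mult_distrib)
  also have "\<dots> \<le> (\<eta> / 2 * ?n) * real d ^ Suc l"
    by (rule mult_right_mono) (use eta2 in auto)
  finally have "?n * (2 * real d * real (card ?B)) \<le> ?n * (\<eta> / 2 * real d ^ Suc l)"
    by (simp add: mult_ac)
  then have "2 * real d * real (card ?B) \<le> \<eta> / 2 * real d ^ Suc l"
    using n by simp
  moreover have "?n * real (card ?B) \<le> 2 * real d * real (card ?B)"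
    by (rule mult_right_mono) (use half' in auto)
  ultimately have "?n * real (card ?B) \<le> \<eta> / 2 * real d ^ Suc l"
    by linarith
  then have B: "real (card ?B) \<le> \<eta> / 2 * (real d ^ Suc l / ?n)"
    using n by (simp add: field_simps)
  have K: "(?n - d) ^ l = (((?n - d) / d) ^ l) * real d ^ l"
    using d by (simp add: power_divide)
  also have "\<dots> \<le> (\<eta> / 4) * real d ^ l"
    using eta1 by (intro mult_right_mono) auto
  also have "\<dots> \<le> \<eta> / 2 * (real d ^ Suc l / ?n)"
  proof -
    have e: "\<eta> \<ge> 0"
    proof -
      have "0 \<le> real (2 ^ Suc l * (l * (card F + l)))" by simp
      then have "0 \<le> \<eta> / 2 * ?n" using eta2 by linarith
      then show ?thesis using n by (simp add: zero_le_mult_iff)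
    qed
    have "\<eta> / 4 * real d ^ l * ?n \<le> \<eta> / 4 * real d ^ l * (2 * real d)"
      using e by (intro mult_left_mono half') auto
    then show ?thesis using n by (simp add: field_simps)
  qed
  finally have "\<bar>real (card (walks V E l u v)) - real d ^ Suc l / ?n\<bar>
      \<le> \<eta> / 2 * (real d ^ Suc l / ?n)"
    using card_walks_deviation[OF reg uv, of l] by linarith
  moreover have "real (card (walks V E l u v)) \<le> card (proper_walks V E F l u v) + card ?B"
    "real (card (proper_walks V E F l u v)) \<le> card (walks V E l u v)"
    using up lo by linarith+
  moreover have "\<eta> * (real d ^ Suc l / ?n)
      = \<eta> / 2 * (real d ^ Suc l / ?n) + \<eta> / 2 * (real d ^ Suc l / ?n)" by simp
  ultimately show ?thesis using B by linarith
qed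

section \<open>Rerouting a row along a cycle\<close>

lemma latin_rectangles_iff:
  "L \<in> latin_rectangles k n \<longleftrightarrow>
     L \<in> {1..k} \<rightarrow>\<^sub>E ({1..n} \<rightarrow>\<^sub>E {1..n}) \<and>
     (\<forall>i\<in>{1..k}. inj_on (L i) {1..n}) \<and> (\<forall>j\<in>{1..n}. inj_on (\<lambda>i. L i j) {1..k})"
  (is "_ \<longleftrightarrow> ?PiE \<and> ?rows \<and> ?cols")
proof
  assume L: "L \<in> latin_rectangles k n"
  then have P: ?PiE by (simp add: latin_rectangles_def)
  have uniq: "\<exists>!j. j \<in> {1..n} \<and> L i j = s" if "i \<in> {1..k}" "s \<in> {1..n}" for i s
    using L that by (simp add: latin_rectangles_def)
  have uniq': "\<exists>\<^sub>\<le>\<^sub>1i. i \<in> {1..k} \<and> L i j = s" if "j \<in> {1..n}" "s \<in> {1..n}" for j s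
    using L that by (simp add: latin_rectangles_def)
  have mem: "L i j \<in> {1..n}" if "i \<in> {1..k}" "j \<in> {1..n}" for i j
    using PiE_mem[OF PiE_mem[OF P that(1)] that(2)] .
  have "inj_on (L i) {1..n}" if i: "i \<in> {1..k}" for i
  proof (rule inj_onI)
    fix a b assume ab: "a \<in> {1..n}" "b \<in> {1..n}" "L i a = L i b"
    show "a = b" using uniq[OF i mem[OF i ab(1)]] ab by metis
  qed
  moreover have "inj_on (\<lambda>i. L i j) {1..k}" if j: "j \<in> {1..n}" for j
  proof (rule inj_onI)
    fix a b assume ab: "a \<in> {1..k}" "b \<in> {1..k}" "L a j = L b j"
    show "a = b" by (rule Uniq_D[OF uniq'[OF j mem[OF ab(1) j]]]) (use ab in auto)
  qed
  ultimately show "?PiE \<and> ?rows \<and> ?cols" using P by simp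
next
  assume *: "?PiE \<and> ?rows \<and> ?cols"
  then have P: ?PiE by simp
  have mem: "L i j \<in> {1..n}" if "i \<in> {1..k}" "j \<in> {1..n}" for i j
    using PiE_mem[OF PiE_mem[OF P that(1)] that(2)] .
  have "\<exists>!j. j \<in> {1..n} \<and> L i j = s" if i: "i \<in> {1..k}" and s: "s \<in> {1..n}" for i s
  proof -
    have inj: "inj_on (L i) {1..n}" using * i by simp
    have "L i ` {1..n} = {1..n}"
      by (rule endo_inj_surj[OF _ _ inj]) (use mem[OF i] in auto)
    then obtain j where "j \<in> {1..n}" "L i j = s" using s by (metis imageE)
    then show ?thesis using inj by (metis inj_onD)
  qed
  moreover have "\<exists>\<^sub>\<le>\<^sub>1i. i \<in> {1..k} \<and> L i j = s" if j: "j \<in> {1..n}" for j s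
  proof (rule Uniq_I)
    fix a b assume ab: "a \<in> {1..k} \<and> L a j = s" "b \<in> {1..k} \<and> L b j = s"
    have "inj_on (\<lambda>i. L i j) {1..k}" using * j by simp
    then show "a = b" by (rule inj_onD) (use ab in auto)
  qed
  ultimately show "L \<in> latin_rectangles k n"
    unfolding latin_rectangles_def using P by simp
qed

lemma latin_rectangle_mem:
  assumes "L \<in> latin_rectangles k n" "i \<in> {1..k}" "j \<in> {1..n}"
  shows "L i j \<in> {1..n}"
proof -
  have P: "L \<in> {1..k} \<rightarrow>\<^sub>E ({1..n} \<rightarrow>\<^sub>E {1..n})"
    using assms(1) by (simp add: latin_rectangles_def)
  show ?thesis using PiE_mem[OF PiE_mem[OF P assms(2)] assms(3)] .
qed

lemma latin_rectangle_row_inj: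
  assumes "L \<in> latin_rectangles k n" "i \<in> {1..k}" "j \<in> {1..n}" "j' \<in> {1..n}" "L i j = L i j'"
  shows "j = j'"
  using assms inj_onD[of "L i" "{1..n}" j j'] by (simp add: latin_rectangles_iff)

lemma latin_rectangle_column_inj:
  assumes "L \<in> latin_rectangles k n" "i \<in> {1..k}" "i' \<in> {1..k}" "j \<in> {1..n}" "L i j = L i' j"
  shows "i = i'"
  using assms inj_onD[of "\<lambda>i. L i j" "{1..k}" i i'] by (simp add: latin_rectangles_iff)

lemma latin_rectangle_row_bij:
  assumes "L \<in> latin_rectangles k n" "i \<in> {1..k}"
  shows "bij_betw (L i) {1..n} {1..n}"
proof -
  have inj: "inj_on (L i) {1..n}" using assms by (simp add: latin_rectangles_iff)
  have "L i ` {1..n} = {1..n}"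
    by (rule endo_inj_surj[OF finite_atLeastAtMost image_subsetI[OF latin_rectangle_mem[OF assms]] inj])
  with inj show ?thesis by (simp add: bij_betw_def)
qed

definition column_without :: "nat \<Rightarrow> (nat \<Rightarrow> nat \<Rightarrow> nat) \<Rightarrow> nat \<Rightarrow> nat \<Rightarrow> nat set" where
  "column_without k L r j = (\<lambda>i. L i j) ` ({1..k} - {r})"

text \<open>
  An arc from \<open>j\<close> to \<open>j'\<close> says that the entry of row \<open>r\<close> in column \<open>j'\<close> could be moved to column \<open>j\<close>
  without repeating a symbol in column \<open>j\<close>.
\<close>

definition switchable :: "nat \<Rightarrow> (nat \<Rightarrow> nat \<Rightarrow> nat) \<Rightarrow> nat \<Rightarrow> nat \<Rightarrow> nat \<Rightarrow> bool" where
  "switchable k L r j j' \<longleftrightarrow> L r j' \<notin> column_without k L r j"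

lemma column_without_upd [simp]: "column_without k (L(r := f)) r j = column_without k L r j"
  by (auto simp: column_without_def)

lemma latin_rectangle_not_in_column_without:
  assumes "L \<in> latin_rectangles k n" "r \<in> {1..k}" "j \<in> {1..n}"
  shows "L r j \<notin> column_without k L r j"
  using latin_rectangle_column_inj[OF assms(1,2) _ assms(3)]
  by (auto simp: column_without_def)

text \<open>
  Each column holds \<open>k - 1\<close> distinct symbols outside row \<open>r\<close>, and each symbol occurs outside row \<open>r\<close> in
  \<open>k - 1\<close> distinct columns; row \<open>r\<close> identifies symbols with columns.  So exactly \<open>k - 1\<close> arcs are missing
  at each vertex in both directions.
\<close>

lemma regular_switchable:
  assumes L: "L \<in> latin_rectangles k n" and r: "r \<in> {1..k}" and "k \<le> n"
  shows "regular_digraph {1..n} (switchable k L r) (n + 1 - k)"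
proof -
  let ?V = "{1..n}"
  have inj: "inj_on (L r) ?V" and im: "L r ` ?V = ?V"
    using latin_rectangle_row_bij[OF L r] by (auto simp: bij_betw_def)
  have out: "card {x\<in>?V. \<not> switchable k L r u x} = k - 1" if u: "u \<in> ?V" for u
  proof -
    have "column_without k L r u \<subseteq> ?V"
      unfolding column_without_def by (rule image_subsetI) (use latin_rectangle_mem[OF L _ u] in blast)
    moreover have "L r ` {x\<in>?V. \<not> switchable k L r u x} = L r ` ?V \<inter> column_without k L r u"
      unfolding switchable_def by blast
    ultimately have "L r ` {x\<in>?V. \<not> switchable k L r u x} = column_without k L r u"
      unfolding im by blast
    moreover have "inj_on (L r) {x\<in>?V. \<not> switchable k L r u x}"
      by (rule inj_on_subset[OF inj]) auto
    ultimately have "card {x\<in>?V. \<not> switchable k L r u x} = card (column_without k L r u)"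
      by (metis card_image)
    also have "inj_on (\<lambda>i. L i u) ({1..k} - {r})"
      using L u by (auto simp: latin_rectangles_iff intro: inj_on_subset)
    then have "card (column_without k L r u) = card ({1..k} - {r})"
      unfolding column_without_def by (rule card_image)
    also have "\<dots> = k - 1" using r by simp
    finally show ?thesis .
  qed
  have "in": "card {x\<in>?V. \<not> switchable k L r x v} = k - 1" if v: "v \<in> ?V" for v
  proof -
    define t where "t = L r v"
    have t: "t \<in> ?V" using latin_rectangle_mem[OF L r v] by (simp add: t_def)
    let ?g = "\<lambda>i. inv_into ?V (L i) t"
    have g: "?g i \<in> ?V" "L i (?g i) = t" if "i \<in> {1..k}" for i
    proof -
      have "t \<in> L i ` ?V" using latin_rectangle_row_bij[OF L that] t by (simp add: bij_betw_def)
      then show "?g i \<in> ?V" "L i (?g i) = t"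
        by (rule inv_into_into, rule f_inv_into_f)
    qed
    have "{x\<in>?V. \<not> switchable k L r x v} = ?g ` ({1..k} - {r})"
    proof (intro equalityI subsetI)
      fix x assume "x \<in> {x\<in>?V. \<not> switchable k L r x v}"
      then have x: "x \<in> ?V" "t \<in> column_without k L r x" by (simp_all add: switchable_def t_def)
      from x(2) obtain i where i: "i \<in> {1..k} - {r}" "t = L i x"
        unfolding column_without_def by (rule imageE)
      have i': "i \<in> {1..k}" using i(1) by blast
      have "L i x = L i (?g i)" using i(2)[symmetric] g(2)[OF i', symmetric] by (rule trans)
      then have "x = ?g i"
        by (rule latin_rectangle_row_inj[OF L i' x(1) g(1)[OF i']])
      then show "x \<in> ?g ` ({1..k} - {r})" using i by blast
    next
      fix x assume "x \<in> ?g ` ({1..k} - {r})"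
      then obtain i where i: "i \<in> {1..k} - {r}" "x = ?g i" by blast
      have "x \<in> ?V" "L i x = t" using g[of i] i by auto
      then show "x \<in> {x\<in>?V. \<not> switchable k L r x v}"
        using i(1) unfolding switchable_def column_without_def t_def[symmetric] by blast
    qed
    moreover have "inj_on ?g ({1..k} - {r})"
    proof (rule inj_onI)
      fix i i' assume i: "i \<in> {1..k} - {r}" "i' \<in> {1..k} - {r}" "?g i = ?g i'"
      then have "L i (?g i) = L i' (?g i)" using g[of i] g[of i'] by simp
      then show "i = i'"
        by (intro latin_rectangle_column_inj[OF L, of i i' "?g i"]) (use i g(1)[of i] in auto)
    qed
    ultimately have "card {x\<in>?V. \<not> switchable k L r x v} = card ({1..k} - {r})"
      by (metis (no_types, lifting) card_image)
    then show ?thesis using r by simp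
  qed
  have compl: "card {x\<in>?V. Q x} = n + 1 - k" if "card {x\<in>?V. \<not> Q x} = k - 1" for Q
  proof -
    have "card {x\<in>?V. Q x} + card {x\<in>?V. \<not> Q x} = card ({x\<in>?V. Q x} \<union> {x\<in>?V. \<not> Q x})"
      by (rule card_Un_disjoint[symmetric]) auto
    also have "{x\<in>?V. Q x} \<union> {x\<in>?V. \<not> Q x} = ?V" by auto
    finally have "card {x\<in>?V. Q x} + (k - 1) = n" using that by simp
    moreover have "k \<ge> 1" using r by simp
    ultimately show ?thesis by linarith
  qed
  show ?thesis
    unfolding regular_digraph_def using compl[OF out] compl[OF "in"] by auto
qed

lemma permuted_row_latin:
  assumes L: "L \<in> latin_rectangles k n" and r: "r \<in> {1..k}" and p: "p permutes {1..n}"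
    and sw: "\<And>j. j \<in> {1..n} \<Longrightarrow> p j \<noteq> j \<Longrightarrow> switchable k L r j (p j)"
  shows "L(r := L r \<circ> p) \<in> latin_rectangles k n"
proof -
  let ?L = "L(r := L r \<circ> p)" and ?V = "{1..n}"
  have pV: "p j \<in> ?V \<longleftrightarrow> j \<in> ?V" for j by (rule permutes_in_image[OF p])
  have PiE: "L \<in> {1..k} \<rightarrow>\<^sub>E (?V \<rightarrow>\<^sub>E ?V)" using L by (simp add: latin_rectangles_iff)
  have "L r \<circ> p \<in> ?V \<rightarrow>\<^sub>E ?V"
  proof (rule PiE_I)
    fix j assume "j \<in> ?V"
    then show "(L r \<circ> p) j \<in> ?V" using latin_rectangle_mem[OF L r] pV by auto
  next
    fix j assume "j \<notin> ?V"
    then show "(L r \<circ> p) j = undefined"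
      using PiE_arb[OF PiE_mem[OF PiE r], of j] permutes_not_in[OF p, of j] by simp
  qed
  then have "?L \<in> {1..k} \<rightarrow>\<^sub>E (?V \<rightarrow>\<^sub>E ?V)"
    using PiE r by (auto simp: PiE_def extensional_def Pi_def)
  moreover have "inj_on (?L i) ?V" if i: "i \<in> {1..k}" for i
  proof (cases "i = r")
    case True
    have "inj_on (L r) (p ` ?V)"
      using L r permutes_image[OF p] by (simp add: latin_rectangles_iff)
    then show ?thesis
      using True permutes_inj_on[OF p] by (simp add: comp_inj_on)
  qed (use L i in \<open>simp add: latin_rectangles_iff\<close>)
  moreover have "inj_on (\<lambda>i. ?L i j) {1..k}" if j: "j \<in> ?V" for j
  proof -
    have new: "L r (p j) \<notin> column_without k L r j"
      using sw[OF j] latin_rectangle_not_in_column_without[OF L r j]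
      by (cases "p j = j") (auto simp: switchable_def)
    have ne: "L r (p j) \<noteq> L i j" if "i \<in> {1..k}" "i \<noteq> r" for i
      using new that unfolding column_without_def by blast
    show ?thesis
    proof (rule inj_onI)
      fix a b assume ab: "a \<in> {1..k}" "b \<in> {1..k}" "?L a j = ?L b j"
      show "a = b"
      proof (cases "a = r \<or> b = r")
        case True
        then show ?thesis using ab ne[of a] ne[of b] by (auto split: if_splits)
      next
        case False
        then show ?thesis using latin_rectangle_column_inj[OF L ab(1,2) j] ab(3) by simp
      qed
    qed
  qed
  ultimately show ?thesis by (simp only: latin_rectangles_iff) blast
qed

lemma cycle_of_list_nth:
  assumes "distinct (c # xs)" "i < length (c # xs)"
  shows "cycle_of_list (c # xs) ((c # xs) ! i) = (xs @ [c]) ! i"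
proof -
  have "map (cycle_of_list (c # xs)) (c # xs) = xs @ [c]"
    using cyclic_rotation[OF assms(1), of 1] by (simp del: cycle_of_list.simps)
  then show ?thesis using assms(2) by (metis nth_map)
qed

text \<open>
  The permutation \<open>cycle_of_list\<close> sends each vertex to its successor on the closed walk.
\<close>

lemma successively_closed_walk_iff:
  assumes "distinct (c # xs)"
  shows "successively E (c # xs @ [c]) \<longleftrightarrow> (\<forall>x\<in>set (c # xs). E x (cycle_of_list (c # xs) x))"
proof -
  have "successively E (c # xs @ [c])
      \<longleftrightarrow> (\<forall>i<length (c # xs). E ((c # xs @ [c]) ! i) ((c # xs @ [c]) ! Suc i))"
    by (auto simp: successively_conv_nth)
  also have "\<dots> \<longleftrightarrow> (\<forall>i<length (c # xs). E ((c # xs) ! i) (cycle_of_list (c # xs) ((c # xs) ! i)))"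
  proof (intro all_cong1 imp_cong refl)
    fix i assume i: "i < length (c # xs)"
    have "(c # xs @ [c]) ! i = (c # xs) ! i"
      using i nth_append[of "c # xs" "[c]" i] by simp
    then show "E ((c # xs @ [c]) ! i) ((c # xs @ [c]) ! Suc i)
        = E ((c # xs) ! i) (cycle_of_list (c # xs) ((c # xs) ! i))"
      by (simp only: cycle_of_list_nth[OF assms i] nth_Cons_Suc)
  qed
  also have "\<dots> \<longleftrightarrow> (\<forall>x\<in>set (c # xs). E x (cycle_of_list (c # xs) x))"
    by (simp only: all_set_conv_all_nth)
  finally show ?thesis .
qed

lemma cycle_of_list_last:
  assumes "distinct (c # ys @ [u])"
  shows "cycle_of_list (c # ys @ [u]) u = c"
  using cycle_of_list_nth[OF assms, of "Suc (length ys)"] by (simp add: nth_append)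

text \<open>
  A pattern is a set of triples (row, column, symbol).
\<close>

definition extensions :: "nat \<Rightarrow> nat \<Rightarrow> (nat \<times> nat \<times> nat) set \<Rightarrow> (nat \<Rightarrow> nat \<Rightarrow> nat) set" where
  "extensions k n P = {L \<in> latin_rectangles k n. \<forall>(i, j, t)\<in>P. L i j = t}"

lemma finite_extensions: "finite (extensions k n P)"
  unfolding extensions_def using finite_latin_rectangles by (rule finite_subset[rotated]) auto

lemma extensions_insert:
  "extensions k n (insert (r, c, s) P) = {L \<in> extensions k n P. L r c = s}"
  by (auto simp: extensions_def)

text \<open>
  The columns whose entry in row \<open>r\<close> must not be moved.
\<close>

definition pattern_columns :: "nat \<Rightarrow> (nat \<times> nat \<times> nat) set \<Rightarrow> nat \<Rightarrow> nat set" where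
  "pattern_columns n P r = {j\<in>{1..n}. \<exists>t. (r, j, t) \<in> P}"

text \<open>
  The two sides of the switching.  On the first side the symbol \<open>s\<close> sits at the cell \<open>(r, c)\<close>, and the
  second component lists the other columns of a cycle through \<open>c\<close> along which row \<open>r\<close> may be rotated.  On
  the second side \<open>s\<close> does not occur in column \<open>c\<close> at all.  There the cycle must be traversed backwards,
  and it must reach \<open>c\<close> from the column that holds \<open>s\<close> in row \<open>r\<close>: so its last column is forced, and one
  choice fewer remains.  The difference in the number of free choices produces the probability of order
  \<open>1 / n\<close>.
\<close>

definition occurrences_through ::
    "nat \<Rightarrow> nat \<Rightarrow> (nat \<times> nat \<times> nat) set \<Rightarrow> nat \<Rightarrow> nat \<Rightarrow> nat \<Rightarrow> nat
      \<Rightarrow> ((nat \<Rightarrow> nat \<Rightarrow> nat) \<times> nat list) set" where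
  "occurrences_through k n P r c s l =
     (SIGMA L : extensions k n (insert (r, c, s) P).
        proper_walks {1..n} (switchable k L r) (insert c (pattern_columns n P r)) (Suc l) c c)"

definition absences_through ::
    "nat \<Rightarrow> nat \<Rightarrow> (nat \<times> nat \<times> nat) set \<Rightarrow> nat \<Rightarrow> nat \<Rightarrow> nat \<Rightarrow> nat
      \<Rightarrow> ((nat \<Rightarrow> nat \<Rightarrow> nat) \<times> nat list) set" where
  "absences_through k n P r c s l =
     (SIGMA L : {L \<in> extensions k n P. \<forall>i\<in>{1..k}. L i c \<noteq> s}.
        (\<lambda>ys. ys @ [inv_into {1..n} (L r) s]) `
          proper_walks {1..n} (\<lambda>x y. switchable k L r y x)
            ({c, inv_into {1..n} (L r) s} \<union> pattern_columns n P r) l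
            c (inv_into {1..n} (L r) s))"

text \<open>
  Rotating row \<open>r\<close> along the cycle is invertible, and the rotated row repeats no symbol of a column
  because the arcs of the cycle are switchable; the arcs of the reversed cycle are switchable after the
  rotation because the rectangle was Latin before it.  Entries of the pattern are not moved, since the
  cycle avoids their columns.
\<close>

lemma reroute_bij:
  assumes r: "r \<in> {1..k}" and c: "c \<in> {1..n}" and s: "s \<in> {1..n}"
    and free_cell: "\<And>t. (r, c, t) \<notin> P" and free_row: "\<And>j. (r, j, s) \<notin> P"
  shows "bij_betw (\<lambda>(L, xs). (L(r := L r \<circ> cycle_of_list (c # xs)), xs))
           (occurrences_through k n P r c s l) (absences_through k n P r c s l)"
proof -
  let ?V = "{1..n}" and ?F = "pattern_columns n P r"
  let ?\<pi> = "\<lambda>xs. cycle_of_list (c # xs)"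
  let ?f = "\<lambda>(L, xs). (L(r := L r \<circ> ?\<pi> xs), xs)"
  let ?g = "\<lambda>(L, xs). (L(r := L r \<circ> inv (?\<pi> xs)), xs)"
  let ?X = "occurrences_through k n P r c s l" and ?Y = "absences_through k n P r c s l"
  have cF: "c \<notin> ?F" using free_cell by (auto simp: pattern_columns_def)
  have perm: "?\<pi> xs permutes ?V" if "set xs \<subseteq> ?V" for xs
    using permutes_subset[OF cycle_permutes, of "c # xs" ?V] c that by simp
  have keep: "?\<pi> xs j = j" if xs: "set xs \<inter> ?F = {}" "set xs \<subseteq> ?V" and P: "(r, j, t) \<in> P" for xs j t
  proof (rule id_outside_supp)
    show "j \<notin> set (c # xs)"
    proof
      assume "j \<in> set (c # xs)"
      moreover from this have "j \<in> ?F" using xs c P by (auto simp: pattern_columns_def)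
      ultimately show False using xs cF by auto
    qed
  qed
  have fwd: "?f (L, xs) \<in> ?Y" if X: "(L, xs) \<in> ?X" for L xs
  proof -
    define L' where "L' = L(r := L r \<circ> ?\<pi> xs)"
    from X have L: "L \<in> latin_rectangles k n" and Lc: "L r c = s"
      and LP: "\<And>i j t. (i, j, t) \<in> P \<Longrightarrow> L i j = t"
      and w: "xs \<in> proper_walks ?V (switchable k L r) (insert c ?F) (Suc l) c c"
      by (auto simp: occurrences_through_def extensions_def)
    from w have len: "length xs = Suc l" and xsV: "set xs \<subseteq> ?V" and dist: "distinct (c # xs)"
      and xsF: "set xs \<inter> ?F = {}" and succ: "successively (switchable k L r) (c # xs @ [c])"
      by (auto simp: proper_walks_def walks_def)
    have sw: "switchable k L r x (?\<pi> xs x)" if "x \<in> set (c # xs)" for x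
      using bspec[OF iffD1[OF successively_closed_walk_iff[OF dist] succ] that] .
    have L': "L' \<in> latin_rectangles k n"
      unfolding L'_def
      by (rule permuted_row_latin[OF L r perm[OF xsV]]) (metis sw id_outside_supp)
    have L'P: "\<forall>(i, j, t)\<in>P. L' i j = t"
    proof clarify
      fix i j t assume P: "(i, j, t) \<in> P"
      show "L' i j = t"
        using LP[OF P] keep[OF xsF xsV, of j t] P by (cases "i = r") (auto simp: L'_def)
    qed
    obtain ys u where yu: "xs = ys @ [u]" using len by (metis append_butlast_last_id list.size(3) nat.distinct(1))
    have u: "u \<in> ?V" "u \<noteq> c" "u \<notin> ?F" "u \<notin> set ys" "c \<notin> set ys" "distinct ys"
      using xsV dist xsF yu by auto
    have L'u: "L' r u = s"
      using cycle_of_list_last[of c ys u] dist Lc yu by (simp add: L'_def del: cycle_of_list.simps)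
    have inv: "inv_into ?V (L' r) s = u"
      using inv_into_f_f[of "L' r" ?V u] latin_rectangle_row_bij[OF L' r] u L'u
      by (simp add: bij_betw_def)
    have T: "L' i c \<noteq> s" if i: "i \<in> {1..k}" for i
    proof (cases "i = r")
      case True
      then show ?thesis using latin_rectangle_row_inj[OF L' r u(1) c] L'u u(2) by auto
    next
      case False
      then have "L i c \<noteq> s" using latin_rectangle_column_inj[OF L i r c] Lc by auto
      then show ?thesis using False by (simp add: L'_def)
    qed
    have "successively (\<lambda>x y. switchable k L' r y x) (c # xs @ [c])"
    proof (subst successively_closed_walk_iff[OF dist], rule ballI)
      fix x assume x: "x \<in> set (c # xs)"
      have "?\<pi> xs x \<in> ?V" using x xsV c permutes_in_image[OF perm[OF xsV], of x] by auto
      then have "L r (?\<pi> xs x) \<notin> column_without k L r (?\<pi> xs x)"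
        by (rule latin_rectangle_not_in_column_without[OF L r])
      then show "switchable k L' r (?\<pi> xs x) x" by (simp add: switchable_def L'_def)
    qed
    then have "successively (\<lambda>x y. switchable k L' r y x) ((c # ys @ [u]) @ [c])"
      by (simp add: yu)
    then have "successively (\<lambda>x y. switchable k L' r y x) (c # ys @ [u])"
      unfolding successively_append_iff by blast
    then have "ys \<in> proper_walks ?V (\<lambda>x y. switchable k L' r y x) ({c, u} \<union> ?F) l c u"
      using u xsV xsF len yu by (auto simp: proper_walks_def walks_def)
    then have "(L', xs) \<in> ?Y"
      using L' L'P T yu inv by (auto simp: absences_through_def extensions_def)
    then show ?thesis by (simp add: L'_def)
  qed
  have bwd: "?g (L', xs) \<in> ?X" if Y: "(L', xs) \<in> ?Y" for L' xs
  proof -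
    define L where "L = L'(r := L' r \<circ> inv (?\<pi> xs))"
    define u where "u = inv_into ?V (L' r) s"
    have "L' \<in> {L \<in> extensions k n P. \<forall>i\<in>{1..k}. L i c \<noteq> s}"
      using Y unfolding absences_through_def by (rule SigmaD1)
    then have L'e: "L' \<in> extensions k n P" and T: "\<forall>i\<in>{1..k}. L' i c \<noteq> s" by simp_all
    from L'e have L': "L' \<in> latin_rectangles k n"
      and L'P: "\<And>i j t. (i, j, t) \<in> P \<Longrightarrow> L' i j = t"
      by (auto simp: extensions_def)
    from Y have "xs \<in> (\<lambda>ys. ys @ [u]) `
        proper_walks ?V (\<lambda>x y. switchable k L' r y x) ({c, u} \<union> ?F) l c u"
      unfolding absences_through_def u_def by (rule SigmaD2)
    then obtain ys where yu: "xs = ys @ [u]"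
      and w: "ys \<in> proper_walks ?V (\<lambda>x y. switchable k L' r y x) ({c, u} \<union> ?F) l c u"
      by (rule imageE)
    have sV: "s \<in> L' r ` ?V" using latin_rectangle_row_bij[OF L' r] s by (simp add: bij_betw_def)
    have u: "u \<in> ?V" "L' r u = s"
      using inv_into_into[OF sV] f_inv_into_f[OF sV] by (simp_all add: u_def)
    have uc: "u \<noteq> c" using T u r by auto
    have uF: "u \<notin> ?F" using L'P u(2) free_row by (force simp: pattern_columns_def)
    from w have len: "length xs = Suc l" and xsV: "set xs \<subseteq> ?V" and dist: "distinct (c # xs)"
      and xsF: "set xs \<inter> ?F = {}" and succ: "successively (\<lambda>x y. switchable k L' r y x) (c # ys @ [u])"
      using yu u(1) uc uF by (auto simp: proper_walks_def walks_def)
    have "switchable k L' r c u"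
      unfolding switchable_def u(2) using T by (auto simp: column_without_def)
    then have "successively (\<lambda>x y. switchable k L' r y x) ((c # ys @ [u]) @ [c])"
      using succ unfolding successively_append_iff by simp
    then have "successively (\<lambda>x y. switchable k L' r y x) (c # xs @ [c])" by (simp add: yu)
    then have "\<forall>x\<in>set (c # xs). switchable k L' r (?\<pi> xs x) x"
      by (simp only: successively_closed_walk_iff[OF dist])
    then have sw: "switchable k L' r (?\<pi> xs x) x" if "x \<in> set (c # xs)" for x
      using that by (rule bspec)
    have p: "?\<pi> xs permutes ?V" by (rule perm[OF xsV])
    have pinv: "?\<pi> xs (inv (?\<pi> xs) x) = x" "inv (?\<pi> xs) (?\<pi> xs x) = x" for x
      using permutes_inverses[OF p] by auto
    have L: "L \<in> latin_rectangles k n"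
      unfolding L_def
    proof (rule permuted_row_latin[OF L' r permutes_inv[OF p]])
      fix j assume "j \<in> ?V" "inv (?\<pi> xs) j \<noteq> j"
      then have "inv (?\<pi> xs) j \<in> set (c # xs)" using id_outside_supp pinv(1) by metis
      then show "switchable k L' r j (inv (?\<pi> xs) j)" using sw pinv(1) by metis
    qed
    have Lc: "L r c = s"
    proof -
      have "?\<pi> xs u = c" using cycle_of_list_last[of c ys u] dist yu by simp
      then have "inv (?\<pi> xs) c = u" using pinv(2) by metis
      then show ?thesis by (simp add: L_def u del: cycle_of_list.simps)
    qed
    have LP: "\<forall>(i, j, t)\<in>P. L i j = t"
    proof clarify
      fix i j t assume P: "(i, j, t) \<in> P"
      show "L i j = t"
      proof (cases "i = r")
        case True
        then have "inv (?\<pi> xs) j = j" using keep[OF xsF xsV, of j t] P pinv(2) by metis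
        then show ?thesis using L'P[OF P] True by (simp add: L_def del: cycle_of_list.simps)
      qed (use L'P[OF P] in \<open>simp add: L_def\<close>)
    qed
    have "successively (switchable k L r) (c # xs @ [c])"
    proof (subst successively_closed_walk_iff[OF dist], rule ballI)
      fix x assume x: "x \<in> set (c # xs)"
      then have "x \<in> ?V" using xsV c by auto
      then have "L' r x \<notin> column_without k L' r x"
        by (rule latin_rectangle_not_in_column_without[OF L' r])
      then show "switchable k L r x (?\<pi> xs x)"
        by (simp add: switchable_def L_def pinv(2) del: cycle_of_list.simps)
    qed
    then have "xs \<in> proper_walks ?V (switchable k L r) (insert c ?F) (Suc l) c c"
      using len xsV xsF dist by (auto simp: proper_walks_def walks_def)
    then have "(L, xs) \<in> ?X"
      using L LP Lc by (auto simp: occurrences_through_def extensions_def)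
    then show ?thesis by (simp add: L_def)
  qed
  have bij: "bij (?\<pi> xs)" for xs using permutation_of_cycle permutation_bijective by blast
  have cancel: "?\<pi> xs \<circ> inv (?\<pi> xs) = id" "inv (?\<pi> xs) \<circ> ?\<pi> xs = id" for xs
    using iffD1[OF surj_iff bij_is_surj[OF bij]] iffD1[OF inj_iff bij_is_inj[OF bij]] .
  have undo: "(h \<circ> ?\<pi> xs) \<circ> inv (?\<pi> xs) = h" "(h \<circ> inv (?\<pi> xs)) \<circ> ?\<pi> xs = h"
    for h :: "nat \<Rightarrow> nat" and xs
    by (simp_all only: comp_assoc cancel comp_id)
  show ?thesis
  proof (rule bij_betw_byWitness[where f' = ?g])
    show "\<forall>a\<in>?X. ?g (?f a) = a"
      by (simp only: split_paired_Ball_Sigma occurrences_through_def prod.case fun_upd_same undo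
          fun_upd_upd fun_upd_triv) simp
    show "\<forall>a\<in>?Y. ?f (?g a) = a"
      by (simp only: split_paired_Ball_Sigma absences_through_def prod.case fun_upd_same undo
          fun_upd_upd fun_upd_triv) simp
    show "?f ` ?X \<subseteq> ?Y"
    proof (rule image_subsetI)
      fix a assume "a \<in> ?X"
      then show "?f a \<in> ?Y" using fwd[of "fst a" "snd a"] by (simp only: prod.collapse)
    qed
    show "?g ` ?Y \<subseteq> ?X"
    proof (rule image_subsetI)
      fix a assume "a \<in> ?Y"
      then show "?g a \<in> ?X" using bwd[of "fst a" "snd a"] by (simp only: prod.collapse)
    qed
  qed
qed

lemma sum_bounds_relative:
  fixes g :: "'a \<Rightarrow> real"
  assumes "\<And>x. x \<in> A \<Longrightarrow> \<bar>g x - a\<bar> \<le> \<eta> * a"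
  shows "(1 - \<eta>) * a * card A \<le> (\<Sum>x\<in>A. g x)" "(\<Sum>x\<in>A. g x) \<le> (1 + \<eta>) * a * card A"
proof -
  have "(\<Sum>x\<in>A. (1 - \<eta>) * a) \<le> (\<Sum>x\<in>A. g x)"
    by (rule sum_mono) (use assms in \<open>force simp: abs_le_iff algebra_simps\<close>)
  then show "(1 - \<eta>) * a * card A \<le> (\<Sum>x\<in>A. g x)" by (simp add: mult_ac)
  have "(\<Sum>x\<in>A. g x) \<le> (\<Sum>x\<in>A. (1 + \<eta>) * a)"
    by (rule sum_mono) (use assms in \<open>force simp: abs_le_iff algebra_simps\<close>)
  then show "(\<Sum>x\<in>A. g x) \<le> (1 + \<eta>) * a * card A" by (simp add: mult_ac)
qed

text \<open>
  Both sides of the switching are counted with \<open>card_proper_walks\<close>: about \<open>d ^ (l + 2) / n\<close> cycles for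
  each rectangle with \<open>s\<close> at \<open>(r, c)\<close>, and about \<open>d ^ (l + 1) / n\<close> for each rectangle whose column \<open>c\<close>
  misses \<open>s\<close>.  Hence the former are about a fraction \<open>1 / d\<close> of the latter.  When
  \<open>k\<close> is bounded away from \<open>n / 2\<close>, the ratio in the first bound stays below a constant smaller than 1.
\<close>

lemma card_extensions_insert_absent:
  fixes \<eta> :: real
  assumes kn: "2 * k \<le> n" and r: "r \<in> {1..k}" and c: "c \<in> {1..n}" and s: "s \<in> {1..n}"
    and free_cell: "\<And>t. (r, c, t) \<notin> P" and free_row: "\<And>j. (r, j, s) \<notin> P"
    and eta1: "2 * ((real k - 1) / (real n + 1 - real k)) ^ l \<le> \<eta> / 2"
    and eta2: "real (2 ^ Suc (Suc l) * (Suc l * (card (pattern_columns n P r) + l + 3))) \<le> \<eta> / 2 * n"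
  defines "d \<equiv> real n + 1 - real k"
    and "T \<equiv> {L \<in> extensions k n P. \<forall>i\<in>{1..k}. L i c \<noteq> s}"
  shows "(1 - \<eta>) * d * card (extensions k n (insert (r, c, s) P)) \<le> (1 + \<eta>) * card T"
    and "(1 - \<eta>) * card T \<le> (1 + \<eta>) * d * card (extensions k n (insert (r, c, s) P))"
proof -
  let ?V = "{1..n}" and ?F = "pattern_columns n P r" and ?A = "extensions k n (insert (r, c, s) P)"
  define a where "a = d ^ Suc l / n"
  have n: "n > 0" using c by simp
  have k: "k \<ge> 1" "k \<le> n" using r kn by auto
  have d: "d > 0" using k by (simp add: d_def)
  have a: "a > 0" using n d by (simp add: a_def)
  have dn: "real (n + 1 - k) = d" using k by (simp add: d_def of_nat_diff)
  have ratio: "(real n - d) / d = (real k - 1) / d" "0 \<le> (real k - 1) / d" "(real k - 1) / d \<le> 1"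
    using k kn d by (simp_all add: d_def)
  have finF: "finite ?F" by (simp add: pattern_columns_def)
  have half: "card ?V \<le> 2 * (n + 1 - k)" using kn by simp
  have card_V: "card ?V = n" by simp
  have fT: "finite T" using finite_extensions by (auto simp: T_def)
  have mono: "real (2 ^ Suc m * (m * (f + m))) \<le> \<eta> / 2 * n" if "m \<le> Suc l" "f \<le> card ?F + 2" for m f
  proof -
    have "2 ^ Suc m * (m * (f + m)) \<le> 2 ^ Suc (Suc l) * (Suc l * (card ?F + l + 3))"
      using that by (intro mult_mono power_increasing) auto
    then have "real (2 ^ Suc m * (m * (f + m))) \<le> real (2 ^ Suc (Suc l) * (Suc l * (card ?F + l + 3)))"
      by (rule of_nat_mono)
    then show ?thesis using eta2 by linarith
  qed
  have fin_walks: "finite (proper_walks ?V E F m u v)" for E F m u v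
    unfolding proper_walks_def using finite_walks[of ?V E m u v] by simp
  have X: "\<bar>real (card (proper_walks ?V (switchable k L r) (insert c ?F) (Suc l) c c)) - d * a\<bar>
      \<le> \<eta> * (d * a)" if "L \<in> ?A" for L
  proof -
    have L: "L \<in> latin_rectangles k n" using that by (simp add: extensions_def)
    have "((real k - 1) / d) ^ Suc l \<le> ((real k - 1) / d) ^ l"
      using ratio by (intro power_decreasing) auto
    then have "2 * ((real (card ?V) - real (n + 1 - k)) / real (n + 1 - k)) ^ Suc l \<le> \<eta> / 2"
      using eta1 unfolding dn d_def[symmetric] by (simp only: card_atLeastAtMost diff_Suc_1 ratio)
    moreover have "real (2 ^ Suc (Suc l) * (Suc l * (card (insert c ?F) + Suc l))) \<le> \<eta> / 2 * card ?V"
      using mono[of "Suc l" "card (insert c ?F)"] card_insert_le_m1[of "card ?F + 2" ?F c] finF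
      by (simp add: card_insert_if)
    ultimately have "\<bar>real (card (proper_walks ?V (switchable k L r) (insert c ?F) (Suc l) c c))
        - d ^ Suc (Suc l) / n\<bar> \<le> \<eta> * (d ^ Suc (Suc l) / n)"
      using card_proper_walks[OF regular_switchable[OF L r k(2)] c c finite.insertI[OF finF] half]
      unfolding dn card_V by blast
    then show ?thesis by (simp add: a_def)
  qed
  have Y: "\<bar>real (card (proper_walks ?V (\<lambda>x y. switchable k L r y x)
            ({c, inv_into ?V (L r) s} \<union> ?F) l c (inv_into ?V (L r) s))) - a\<bar> \<le> \<eta> * a"
    if "L \<in> T" for L
  proof -
    have L: "L \<in> latin_rectangles k n" using that by (simp add: extensions_def T_def)
    define u where "u = inv_into ?V (L r) s"
    have "s \<in> L r ` ?V" using latin_rectangle_row_bij[OF L r] s by (simp add: bij_betw_def)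
    then have u: "u \<in> ?V" unfolding u_def by (rule inv_into_into)
    have "card ({c, u} \<union> ?F) \<le> card ?F + 2"
      using card_Un_le[of "{c, u}" ?F] card_insert_le_m1[of 2 "{u}" c] by simp
    then have "real (2 ^ Suc l * (l * (card ({c, u} \<union> ?F) + l))) \<le> \<eta> / 2 * card ?V"
      using mono[of l "card ({c, u} \<union> ?F)"] by simp
    moreover have "2 * ((real (card ?V) - real (n + 1 - k)) / real (n + 1 - k)) ^ l \<le> \<eta> / 2"
      using eta1 unfolding dn d_def[symmetric] by (simp only: card_atLeastAtMost diff_Suc_1 ratio)
    moreover have "finite ({c, u} \<union> ?F)" using finF by simp
    ultimately show ?thesis
      using card_proper_walks[OF regular_digraph_conversep[OF regular_switchable[OF L r k(2)]] c u _ half]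
      unfolding dn a_def u_def[symmetric] card_V by blast
  qed
  have "card (occurrences_through k n P r c s l) = (\<Sum>L\<in>?A. card (proper_walks ?V (switchable k L r) (insert c ?F) (Suc l) c c))"
    unfolding occurrences_through_def
    by (rule card_SigmaI) (use finite_extensions fin_walks in auto)
  then have cX: "real (card (occurrences_through k n P r c s l))
      = (\<Sum>L\<in>?A. real (card (proper_walks ?V (switchable k L r) (insert c ?F) (Suc l) c c)))"
    by simp
  have "card (absences_through k n P r c s l) = (\<Sum>L\<in>T. card ((\<lambda>ys. ys @ [inv_into ?V (L r) s]) ` proper_walks ?V (\<lambda>x y. switchable k L r y x)
            ({c, inv_into ?V (L r) s} \<union> ?F) l c (inv_into ?V (L r) s)))"
    unfolding absences_through_def T_def[symmetric]
    by (rule card_SigmaI) (use fT fin_walks in auto)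
  also have "\<dots> = (\<Sum>L\<in>T. card (proper_walks ?V (\<lambda>x y. switchable k L r y x)
            ({c, inv_into ?V (L r) s} \<union> ?F) l c (inv_into ?V (L r) s)))"
    by (intro sum.cong refl card_image inj_onI) simp
  finally have cY: "real (card (absences_through k n P r c s l))
      = (\<Sum>L\<in>T. real (card (proper_walks ?V (\<lambda>x y. switchable k L r y x)
            ({c, inv_into ?V (L r) s} \<union> ?F) l c (inv_into ?V (L r) s))))"
    by simp
  have eq: "card (occurrences_through k n P r c s l) = card (absences_through k n P r c s l)"
    by (rule bij_betw_same_card[OF reroute_bij[OF r c s free_cell free_row]])
  have Xb: "(1 - \<eta>) * (d * a) * card ?A \<le> card (occurrences_through k n P r c s l)"
    "card (occurrences_through k n P r c s l) \<le> (1 + \<eta>) * (d * a) * card ?A"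
    unfolding cX by (rule sum_bounds_relative[OF X], assumption)+
  have Yb: "(1 - \<eta>) * a * card T \<le> card (absences_through k n P r c s l)"
    "card (absences_through k n P r c s l) \<le> (1 + \<eta>) * a * card T"
    unfolding cY by (rule sum_bounds_relative[OF Y], assumption)+
  have "(1 - \<eta>) * (d * a) * card ?A \<le> (1 + \<eta>) * a * card T"
    using Xb(1) Yb(2) eq by linarith
  then have "a * ((1 - \<eta>) * d * card ?A) \<le> a * ((1 + \<eta>) * card T)" by (simp add: mult_ac)
  then show "(1 - \<eta>) * d * card ?A \<le> (1 + \<eta>) * card T" using a by simp
  have "(1 - \<eta>) * a * card T \<le> (1 + \<eta>) * (d * a) * card ?A"
    using Xb(2) Yb(1) eq by linarith
  then have "a * ((1 - \<eta>) * card T) \<le> a * ((1 + \<eta>) * d * card ?A)" by (simp add: mult_ac)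
  then show "(1 - \<eta>) * card T \<le> (1 + \<eta>) * d * card ?A" using a by simp
qed

section \<open>The conditional probability of one more entry\<close>

text \<open>
  The bound \<open>b\<close> limits the entries in each row, the entries in each column and the occurrences of each
  symbol.
\<close>

definition sparse_pattern :: "nat \<Rightarrow> nat \<Rightarrow> real \<Rightarrow> (nat \<times> nat \<times> nat) set \<Rightarrow> bool" where
  "sparse_pattern k n b P \<longleftrightarrow> P \<subseteq> {1..k} \<times> {1..n} \<times> {1..n} \<and>
     (\<forall>i. real (card (pattern_columns n P i)) \<le> b) \<and>
     (\<forall>j. real (card {i\<in>{1..k}. \<exists>t. (i, j, t) \<in> P}) \<le> b) \<and>
     (\<forall>t. real (card {i\<in>{1..k}. \<exists>j. (i, j, t) \<in> P}) \<le> b)"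

definition compatible_entry :: "(nat \<times> nat \<times> nat) set \<Rightarrow> nat \<Rightarrow> nat \<Rightarrow> nat \<Rightarrow> bool" where
  "compatible_entry P r c s \<longleftrightarrow>
     (\<forall>t. (r, c, t) \<notin> P) \<and> (\<forall>j. (r, j, s) \<notin> P) \<and> (\<forall>i. (i, c, s) \<notin> P)"

lemma card_extensions_split_column:
  assumes c: "c \<in> {1..n}"
  shows "card (extensions k n P) = card {L \<in> extensions k n P. \<forall>i\<in>{1..k}. L i c \<noteq> s}
           + (\<Sum>i\<in>{1..k}. card (extensions k n (insert (i, c, s) P)))"
proof -
  let ?T = "{L \<in> extensions k n P. \<forall>i\<in>{1..k}. L i c \<noteq> s}"
  let ?X = "\<lambda>i. {L \<in> extensions k n P. L i c = s}"
  have "extensions k n P = ?T \<union> (\<Union>i\<in>{1..k}. ?X i)" by blast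
  then have "card (extensions k n P) = card (?T \<union> (\<Union>i\<in>{1..k}. ?X i))" by simp
  also have "\<dots> = card ?T + card (\<Union>i\<in>{1..k}. ?X i)"
    by (rule card_Un_disjoint) (use finite_extensions in auto)
  also have "card (\<Union>i\<in>{1..k}. ?X i) = (\<Sum>i\<in>{1..k}. card (?X i))"
  proof (rule card_UN_disjoint)
    show "\<forall>i\<in>{1..k}. \<forall>j\<in>{1..k}. i \<noteq> j \<longrightarrow> ?X i \<inter> ?X j = {}"
    proof (intro ballI impI)
      fix i j assume ij: "i \<in> {1..k}" "j \<in> {1..k}" "i \<noteq> j"
      show "?X i \<inter> ?X j = {}"
      proof (rule ccontr)
        assume "?X i \<inter> ?X j \<noteq> {}"
        then obtain L where "L \<in> extensions k n P" "L i c = s" "L j c = s" by blast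
        then have eq: "L i c = L j c" and L: "L \<in> latin_rectangles k n" by (simp_all add: extensions_def)
        show False using latin_rectangle_column_inj[OF L ij(1,2) c eq] ij(3) by simp
      qed
    qed
  qed (use finite_extensions in auto)
  finally show ?thesis by (simp only: extensions_insert)
qed

lemma extensions_insert_incompatible:
  assumes P: "P \<subseteq> {1..k} \<times> {1..n} \<times> {1..n}" and rc: "r \<in> {1..k}" "c \<in> {1..n}"
    and new: "\<And>t. (r, c, t) \<in> P \<Longrightarrow> t \<noteq> s" and inc: "\<not> compatible_entry P r c s"
  shows "extensions k n (insert (r, c, s) P) = {}"
proof (rule ccontr)
  assume "extensions k n (insert (r, c, s) P) \<noteq> {}"
  then obtain L where "L \<in> extensions k n (insert (r, c, s) P)" by blast
  then have L: "L \<in> latin_rectangles k n" "L r c = s"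
    and LP: "\<And>i j t. (i, j, t) \<in> P \<Longrightarrow> L i j = t"
    by (auto simp: extensions_def)
  from inc consider t where "(r, c, t) \<in> P" | j where "(r, j, s) \<in> P" | i where "(i, c, s) \<in> P"
    by (auto simp: compatible_entry_def)
  then show False
  proof cases
    case 1
    then show ?thesis using new LP L(2) by blast
  next
    case 2
    then have "j \<in> {1..n}" "L r j = L r c" using P LP L(2) by auto
    then have "j = c" using latin_rectangle_row_inj[OF L(1) rc(1) _ rc(2)] by blast
    then show ?thesis using 2 new by blast
  next
    case 3
    then have "i \<in> {1..k}" "L i c = L r c" using P LP L(2) by auto
    then have "i = r" using latin_rectangle_column_inj[OF L(1) _ rc(1) rc(2)] by blast
    then show ?thesis using 3 new by blast
  qed
qed

text \<open>
  Let \<open>d = n + 1 - k\<close>, and write \<open>T\<close> for the number of extensions whose column \<open>c\<close> misses \<open>s\<close>.  By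
  \<open>card_extensions_insert_absent\<close>, each row \<open>i\<close> in which \<open>(i, c, s)\<close> is compatible with the pattern
  contributes about \<open>T / d\<close> extensions.  All but few rows are of this kind, so all extensions together
  number about \<open>T + k T / d = (n + 1) T / d\<close>, which is about \<open>n\<close> times the contribution of row \<open>r\<close>.
\<close>

lemma card_extensions_insert:
  fixes \<epsilon> \<beta> :: real
  assumes kn: "2 * k \<le> n" and rcs: "r \<in> {1..k}" "c \<in> {1..n}" "s \<in> {1..n}"
    and sparse: "sparse_pattern k n (\<beta> * n) P" and comp: "compatible_entry P r c s"
    and eps: "0 < \<epsilon>" "\<epsilon> \<le> 1" and beta: "\<beta> \<le> \<epsilon> / 16" and n: "8 / \<epsilon> \<le> n"
    and eta1: "2 * ((real k - 1) / (real n + 1 - real k)) ^ l \<le> \<epsilon> / 48"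
    and eta2: "2 ^ Suc (Suc l) * (Suc l * (\<beta> * n + l + 3)) \<le> \<epsilon> / 48 * n"
  shows "\<bar>real n * card (extensions k n (insert (r, c, s) P)) - card (extensions k n P)\<bar>
      \<le> \<epsilon> * card (extensions k n P)"
proof -
  \<comment> \<open>The two-sided bounds with \<open>\<eta>\<close> have the quotient \<open>(1 + \<eta>) / (1 - \<eta>)\<close>, which \<open>1 + \<theta>\<close> dominates.\<close>
  define \<eta> \<theta> where "\<eta> = \<epsilon> / 24" and "\<theta> = \<epsilon> / 8"
  define d where "d = real n + 1 - real k"
  define x where "x i = real (card (extensions k n (insert (i, c, s) P)))" for i
  define T where "T = real (card {L \<in> extensions k n P. \<forall>i\<in>{1..k}. L i c \<noteq> s})"
  define t where "t = T / d"
  define A where "A = {i\<in>{1..k}. compatible_entry P i c s}"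
  define N where "N = real (card (extensions k n P))"
  have n0: "n > 0" using rcs by simp
  have d: "d > 0" using kn n0 by (simp add: d_def)
  have T0: "T \<ge> 0" and t0: "t \<ge> 0" using d by (simp_all add: T_def t_def)
  have Td: "T = t * d" using d by (simp add: t_def)
  have col_c: "(i, c, s) \<notin> P" for i using comp by (simp add: compatible_entry_def)
  have P: "P \<subseteq> {1..k} \<times> {1..n} \<times> {1..n}" using sparse by (simp add: sparse_pattern_def)
  have eta: "0 < \<eta>" "\<eta> \<le> 1 / 24" using eps by (simp_all add: \<eta>_def)
  have x: "(1 - \<theta>) * t \<le> x i" "x i \<le> (1 + \<theta>) * t" if i: "i \<in> A" for i
  proof -
    have i': "i \<in> {1..k}" and ic: "compatible_entry P i c s" using i by (simp_all add: A_def)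
    have pc: "card (pattern_columns n P i) \<le> \<beta> * n" using sparse by (simp add: sparse_pattern_def)
    have "real (2 ^ Suc (Suc l) * (Suc l * (card (pattern_columns n P i) + l + 3)))
        = 2 ^ Suc (Suc l) * (Suc l * (real (card (pattern_columns n P i)) + l + 3))"
      by (simp only: of_nat_mult of_nat_add of_nat_power of_nat_numeral)
    also have "\<dots> \<le> 2 ^ Suc (Suc l) * (Suc l * (\<beta> * n + l + 3))"
      by (intro mult_left_mono add_right_mono pc) auto
    also have "\<dots> \<le> \<eta> / 2 * n" using eta2 by (simp add: \<eta>_def)
    finally have e2: "real (2 ^ Suc (Suc l) * (Suc l * (card (pattern_columns n P i) + l + 3))) \<le> \<eta> / 2 * n" .
    have e1: "2 * ((real k - 1) / (real n + 1 - real k)) ^ l \<le> \<eta> / 2" using eta1 by (simp add: \<eta>_def)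
    have free: "(i, c, t) \<notin> P" "(i, j, s) \<notin> P" for t j
      using ic by (simp_all add: compatible_entry_def)
    note * = card_extensions_insert_absent[OF kn i' rcs(2,3) free e1 e2, folded d_def x_def T_def]
    have "d * ((1 - \<eta>) * x i) \<le> d * ((1 + \<eta>) * t)" "d * ((1 - \<eta>) * t) \<le> d * ((1 + \<eta>) * x i)"
      using * unfolding Td by (simp_all add: mult_ac)
    then have **: "(1 - \<eta>) * x i \<le> (1 + \<eta>) * t" "(1 - \<eta>) * t \<le> (1 + \<eta>) * x i"
      using d by simp_all
    have "1 + \<eta> \<le> (1 - \<eta>) * (1 + \<theta>)"
      using eps by (simp add: \<eta>_def \<theta>_def field_simps)
    then have "(1 - \<eta>) * x i \<le> (1 - \<eta>) * ((1 + \<theta>) * t)"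
      using **(1) mult_right_mono[OF _ t0, of "1 + \<eta>" "(1 - \<eta>) * (1 + \<theta>)"] by (simp add: mult_ac)
    then show "x i \<le> (1 + \<theta>) * t" using eta by simp
    have "(1 + \<eta>) * (1 - \<theta>) \<le> 1 - \<eta>"
      using eps by (simp add: \<eta>_def \<theta>_def field_simps)
    then have "(1 + \<eta>) * ((1 - \<theta>) * t) \<le> (1 + \<eta>) * x i"
      using **(2) mult_right_mono[OF _ t0, of "(1 + \<eta>) * (1 - \<theta>)" "1 - \<eta>"] by (simp add: mult_ac)
    then show "(1 - \<theta>) * t \<le> x i" using eta by simp
  qed
  have A: "A \<subseteq> {1..k}" by (auto simp: A_def)
  then have finA: "finite A" and cA: "card A \<le> k"
    using finite_subset[OF A] card_mono[OF _ A] by simp_all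
  have "{1..k} \<subseteq> A \<union> {i\<in>{1..k}. \<exists>t. (i, c, t) \<in> P} \<union> {i\<in>{1..k}. \<exists>j. (i, j, s) \<in> P}"
    using col_c by (auto simp: A_def compatible_entry_def)
  then have "card {1..k} \<le> card (A \<union> {i\<in>{1..k}. \<exists>t. (i, c, t) \<in> P} \<union> {i\<in>{1..k}. \<exists>j. (i, j, s) \<in> P})"
    by (rule card_mono[rotated]) (use finA in auto)
  also have "\<dots> \<le> card A + card {i\<in>{1..k}. \<exists>t. (i, c, t) \<in> P} + card {i\<in>{1..k}. \<exists>j. (i, j, s) \<in> P}"
    by (meson add_mono_thms_linordered_semiring(3) card_Un_le order_trans)
  finally have "real k \<le> real (card A) + real (card {i\<in>{1..k}. \<exists>t. (i, c, t) \<in> P})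
      + real (card {i\<in>{1..k}. \<exists>j. (i, j, s) \<in> P})" by simp
  moreover have "real (card {i\<in>{1..k}. \<exists>t. (i, c, t) \<in> P}) \<le> \<beta> * n"
    "real (card {i\<in>{1..k}. \<exists>j. (i, j, s) \<in> P}) \<le> \<beta> * n"
    using sparse unfolding sparse_pattern_def by blast+
  ultimately have kA: "real k - 2 * \<beta> * n \<le> card A" by linarith
  have "x i = 0" if "i \<in> {1..k} - A" for i
  proof -
    have i: "i \<in> {1..k}" "\<not> compatible_entry P i c s" using that unfolding A_def by simp_all
    have "t \<noteq> s" if "(i, c, t) \<in> P" for t using that col_c[of i] by metis
    then have "extensions k n (insert (i, c, s) P) = {}"
      by (rule extensions_insert_incompatible[OF P i(1) rcs(2) _ i(2)])
    then show ?thesis by (simp add: x_def)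
  qed
  then have "(\<Sum>i\<in>{1..k}. x i) = (\<Sum>i\<in>A. x i)"
    by (intro sum.mono_neutral_right[OF finite_atLeastAtMost A]) blast
  moreover have "N = T + (\<Sum>i\<in>{1..k}. x i)"
    unfolding N_def T_def x_def card_extensions_split_column[OF rcs(2), of k P s]
    by (simp only: of_nat_add of_nat_sum)
  ultimately have N: "N = t * d + (\<Sum>i\<in>A. x i)" using Td by simp
  have th: "0 < \<theta>" "\<theta> \<le> 1 / 8" using eps by (simp_all add: \<theta>_def)
  have k_n: "real k \<le> n" using kn by simp
  have up: "N \<le> t * (n * (1 + 2 * \<theta>))"
  proof -
    have "(\<Sum>i\<in>A. x i) \<le> (\<Sum>i\<in>A. (1 + \<theta>) * t)" by (rule sum_mono) (rule x)
    also have "\<dots> = card A * ((1 + \<theta>) * t)" by simp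
    also have "\<dots> \<le> k * ((1 + \<theta>) * t)"
      by (rule mult_right_mono) (use cA th t0 in auto)
    finally have "N \<le> t * (d + k * (1 + \<theta>))" unfolding N by (simp add: algebra_simps)
    also have "\<dots> \<le> t * (n * (1 + 2 * \<theta>))"
    proof (rule mult_left_mono[OF _ t0])
      have "1 \<le> n * \<theta>" using n eps by (simp add: \<theta>_def field_simps)
      moreover have "k * \<theta> \<le> n * \<theta>" using k_n th by simp
      ultimately show "d + k * (1 + \<theta>) \<le> n * (1 + 2 * \<theta>)" by (simp add: d_def algebra_simps)
    qed
    finally show ?thesis .
  qed
  have lo: "t * (n * (1 - 2 * \<theta>)) \<le> N"
  proof -
    have "2 * \<beta> * n \<le> \<theta> * n" using beta by (intro mult_right_mono) (auto simp: \<theta>_def)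
    then have kA': "real k - \<theta> * n \<le> card A" using kA by linarith
    have "n * (1 - 2 * \<theta>) \<le> d + (real k - \<theta> * n) * (1 - \<theta>)"
    proof -
      have "k * \<theta> \<le> n * \<theta>" using k_n th by simp
      moreover have "0 \<le> \<theta> * n * \<theta>" using th by simp
      ultimately show ?thesis by (simp add: d_def algebra_simps)
    qed
    also have "\<dots> \<le> d + card A * (1 - \<theta>)"
      using kA' th by (intro add_left_mono mult_right_mono) auto
    finally have "t * (n * (1 - 2 * \<theta>)) \<le> t * (d + card A * (1 - \<theta>))"
      by (rule mult_left_mono) (rule t0)
    also have "\<dots> = t * d + (\<Sum>i\<in>A. (1 - \<theta>) * t)" by (simp add: algebra_simps)
    also have "\<dots> \<le> N" unfolding N by (intro add_left_mono sum_mono x)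
    finally show ?thesis .
  qed
  have rA: "r \<in> A" using rcs comp by (simp add: A_def)
  have N0: "N \<ge> 0" by (simp add: N_def)
  have "n * x r \<le> (1 + \<epsilon>) * N"
  proof -
    have "n * x r \<le> (1 + \<theta>) * (t * n)" using mult_left_mono[OF x(2)[OF rA], of n] by (simp add: mult_ac)
    also have "\<dots> \<le> ((1 + \<epsilon>) * (1 - 2 * \<theta>)) * (t * n)"
    proof (rule mult_right_mono)
      have "\<epsilon> * \<epsilon> \<le> \<epsilon>" using eps by simp
      moreover have "(1 + \<epsilon>) * (1 - 2 * \<theta>) - (1 + \<theta>) = 5 / 8 * \<epsilon> - 1 / 4 * (\<epsilon> * \<epsilon>)"
        by (simp add: \<theta>_def algebra_simps)
      ultimately show "1 + \<theta> \<le> (1 + \<epsilon>) * (1 - 2 * \<theta>)" using eps by linarith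
    qed (use t0 in simp)
    also have "\<dots> = (1 + \<epsilon>) * (t * (n * (1 - 2 * \<theta>)))" by (simp add: mult_ac)
    also have "\<dots> \<le> (1 + \<epsilon>) * N" by (rule mult_left_mono[OF lo]) (use eps in simp)
    finally show ?thesis .
  qed
  moreover have "(1 - \<epsilon>) * N \<le> n * x r"
  proof -
    have "(1 - \<epsilon>) * N \<le> (1 - \<epsilon>) * (t * (n * (1 + 2 * \<theta>)))"
      by (rule mult_left_mono[OF up]) (use eps in simp)
    also have "\<dots> = ((1 - \<epsilon>) * (1 + 2 * \<theta>)) * (t * n)" by (simp add: mult_ac)
    also have "\<dots> \<le> (1 - \<theta>) * (t * n)"
    proof (rule mult_right_mono)
      have "0 \<le> \<epsilon> * \<epsilon>" by simp
      then show "(1 - \<epsilon>) * (1 + 2 * \<theta>) \<le> 1 - \<theta>" using eps unfolding \<theta>_def by (simp add: algebra_simps)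
    qed (use t0 in simp)
    also have "\<dots> \<le> n * x r" using mult_left_mono[OF x(1)[OF rA], of n] by (simp add: mult_ac)
    finally show ?thesis .
  qed
  ultimately show ?thesis unfolding N_def x_def abs_le_iff by (simp add: algebra_simps)
qed

definition nearly_uniform_entries :: "nat \<Rightarrow> nat \<Rightarrow> real \<Rightarrow> real \<Rightarrow> bool" where
  "nearly_uniform_entries k n b \<epsilon> \<longleftrightarrow>
     (\<forall>P. \<forall>r\<in>{1..k}. \<forall>c\<in>{1..n}. \<forall>s\<in>{1..n}.
        sparse_pattern k n b P \<longrightarrow> compatible_entry P r c s \<longrightarrow>
        \<bar>real n * card (extensions k n (insert (r, c, s) P)) - card (extensions k n P)\<bar>
          \<le> \<epsilon> * card (extensions k n P))"

text \<open>
  The walk length is chosen first, so that the geometric error is below a fixed multiple of \<open>\<epsilon>\<close>; the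
  sparsity \<open>\<beta>\<close> is chosen small compared with the resulting constant \<open>D\<close>, and \<open>n\<close> large.
\<close>

lemma eventually_nearly_uniform_entries:
  fixes \<epsilon> \<alpha> :: real
  assumes eps: "0 < \<epsilon>" "\<epsilon> \<le> 1" and alpha: "0 < \<alpha>"
  obtains \<beta> :: real and n0 :: nat where "\<beta> > 0"
    "\<And>n k. n \<ge> n0 \<Longrightarrow> real k < (1/2 - \<alpha>) * n \<Longrightarrow> nearly_uniform_entries k n (\<beta> * n) \<epsilon>"
proof -
  \<comment> \<open>The quotient is negative for \<open>\<alpha> > 1/2\<close>; no \<open>k\<close> satisfies the hypothesis then.\<close>
  define \<rho> where "\<rho> = max 0 ((1/2 - \<alpha>) / (1/2 + \<alpha>))"
  have "(1/2 - \<alpha>) / (1/2 + \<alpha>) < 1" using alpha by (simp add: divide_less_eq)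
  then have rho: "0 \<le> \<rho>" "\<rho> < 1" by (simp_all add: \<rho>_def)
  have "\<exists>l. \<rho> ^ l < \<epsilon> / 96" using real_arch_pow_inv[of "\<epsilon> / 96" \<rho>] eps rho by auto
  then obtain l where l: "\<rho> ^ l < \<epsilon> / 96" ..
  define D where "D = 2 ^ Suc (Suc l) * real (Suc l)"
  have "(0::nat) < 2 ^ Suc (Suc l) * Suc l" by (rule mult_pos_pos) simp_all
  then have "(1::nat) \<le> 2 ^ Suc (Suc l) * Suc l" by linarith
  then have "real 1 \<le> real (2 ^ Suc (Suc l) * Suc l)" by (rule of_nat_mono)
  then have D: "D \<ge> 1" by (simp add: D_def distrib_left)
  define \<beta> where "\<beta> = \<epsilon> / (96 * D)"
  define n0 where "n0 = nat \<lceil>max (8 / \<epsilon>) (96 * D * (real l + 3) / \<epsilon>)\<rceil>"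
  have "\<epsilon> / (96 * D) \<le> \<epsilon> / 16" by (rule frac_le) (use eps D in auto)
  then have beta: "\<beta> > 0" "\<beta> \<le> \<epsilon> / 16" using eps D by (simp_all add: \<beta>_def)
  show ?thesis
  proof (rule that[of \<beta> n0])
    show "\<beta> > 0" by (rule beta)
    fix n k :: nat
    assume nn: "n \<ge> n0" and k: "real k < (1/2 - \<alpha>) * n"
    show "nearly_uniform_entries k n (\<beta> * n) \<epsilon>"
      unfolding nearly_uniform_entries_def
    proof (intro allI ballI impI)
      fix P r c s
      assume sp: "sparse_pattern k n (\<beta> * n) P"
        and rcs: "r \<in> {1..k}" "c \<in> {1..n}" "s \<in> {1..n}" "compatible_entry P r c s"
      have n: "8 / \<epsilon> \<le> n" "96 * D * (real l + 3) / \<epsilon> \<le> n"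
        using nn unfolding n0_def by linarith+
      have npos: "n > 0" using rcs by simp
      have kn: "2 * k \<le> n"
      proof -
        have "0 \<le> \<alpha> * n" using alpha by simp
        then have "2 * real k \<le> n" using k by (simp add: left_diff_distrib)
        then show ?thesis by linarith
      qed
      have "(real k - 1) / (real n + 1 - real k) \<le> \<rho>"
      proof -
        have "(real k - 1) * (1/2 + \<alpha>) \<le> ((1/2 - \<alpha>) * n) * (1/2 + \<alpha>)"
          using k alpha by (intro mult_right_mono) auto
        also have "\<dots> = (1/2 - \<alpha>) * ((1/2 + \<alpha>) * n)" by simp
        also have "\<dots> \<le> (1/2 - \<alpha>) * (real n + 1 - real k)"
        proof (rule mult_left_mono)
          show "(1/2 + \<alpha>) * n \<le> real n + 1 - real k" using k by (simp add: algebra_simps)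
          have "0 < (1/2 - \<alpha>) * n" using k by linarith
          then show "0 \<le> 1/2 - \<alpha>" using npos by (simp add: zero_less_mult_iff)
        qed
        finally have "(real k - 1) / (real n + 1 - real k) \<le> (1/2 - \<alpha>) / (1/2 + \<alpha>)"
          using alpha kn by (simp add: field_simps)
        then show ?thesis by (simp add: \<rho>_def)
      qed
      moreover have "0 \<le> (real k - 1) / (real n + 1 - real k)" using rcs kn by simp
      ultimately have "((real k - 1) / (real n + 1 - real k)) ^ l \<le> \<rho> ^ l" by (rule power_mono)
      then have e1: "2 * ((real k - 1) / (real n + 1 - real k)) ^ l \<le> \<epsilon> / 48" using l by linarith
      have "2 ^ Suc (Suc l) * (Suc l * (\<beta> * n + l + 3)) = D * \<beta> * n + D * (real l + 3)"
        by (simp add: D_def algebra_simps)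
      also have "D * \<beta> * n = \<epsilon> / 96 * n" using D by (simp add: \<beta>_def)
      also have "D * (real l + 3) \<le> \<epsilon> / 96 * n" using n(2) eps by (simp add: field_simps)
      finally have e2: "2 ^ Suc (Suc l) * (Suc l * (\<beta> * n + l + 3)) \<le> \<epsilon> / 48 * n" by simp
      show "\<bar>real n * card (extensions k n (insert (r, c, s) P)) - card (extensions k n P)\<bar>
           \<le> \<epsilon> * card (extensions k n P)"
        by (rule card_extensions_insert[OF kn rcs(1-3) sp rcs(4) eps beta(2) n(1) e1 e2])
    qed
  qed
qed

section \<open>The probability of a prescribed block\<close>

definition pattern_of :: "(nat \<Rightarrow> nat \<Rightarrow> nat) \<Rightarrow> (nat \<times> nat) set \<Rightarrow> (nat \<times> nat \<times> nat) set" where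
  "pattern_of f D = (\<lambda>(i, j). (i, j, f i j)) ` D"

lemma mem_pattern_of: "(i, j, t) \<in> pattern_of f D \<longleftrightarrow> (i, j) \<in> D \<and> t = f i j"
  by (auto simp: pattern_of_def)

lemma sparse_pattern_of:
  assumes R: "R \<subseteq> {1..k}" "real (card R) \<le> b" and Q: "Q \<subseteq> {1..n}" "real (card Q) \<le> b"
    and D: "D \<subseteq> R \<times> Q" and f: "\<And>i j. (i, j) \<in> D \<Longrightarrow> f i j \<in> {1..n}"
  shows "sparse_pattern k n b (pattern_of f D)"
proof -
  have fin: "finite R" "finite Q" using R Q finite_subset by blast+
  have leR: "real (card A) \<le> b" if "A \<subseteq> R" for A
    using card_mono[OF fin(1) that] R(2) by linarith
  have leQ: "real (card A) \<le> b" if "A \<subseteq> Q" for A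
    using card_mono[OF fin(2) that] Q(2) by linarith
  have "pattern_of f D \<subseteq> {1..k} \<times> {1..n} \<times> {1..n}"
  proof
    fix x assume "x \<in> pattern_of f D"
    then obtain i j where "x = (i, j, f i j)" "(i, j) \<in> D" by (auto simp: pattern_of_def)
    then show "x \<in> {1..k} \<times> {1..n} \<times> {1..n}" using f[of i j] D R(1) Q(1) by auto
  qed
  moreover have "real (card (pattern_columns n (pattern_of f D) i)) \<le> b" for i
    by (rule leQ) (use D in \<open>auto simp: pattern_columns_def mem_pattern_of\<close>)
  moreover have "real (card {i\<in>{1..k}. \<exists>t. (i, j, t) \<in> pattern_of f D}) \<le> b" for j
    by (rule leR) (use D in \<open>auto simp: mem_pattern_of\<close>)
  moreover have "real (card {i\<in>{1..k}. \<exists>j. (i, j, t) \<in> pattern_of f D}) \<le> b" for t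
    by (rule leR) (use D in \<open>auto simp: mem_pattern_of\<close>)
  ultimately show ?thesis by (simp add: sparse_pattern_def)
qed

lemma extensions_empty: "extensions k n {} = latin_rectangles k n"
  by (simp add: extensions_def)

lemma pattern_of_insert:
  "pattern_of f (insert (i, j) D) = insert (i, j, f i j) (pattern_of f D)"
  by (simp add: pattern_of_def)

lemma nearly_uniform_entriesD:
  assumes "nearly_uniform_entries k n b \<epsilon>" "r \<in> {1..k}" "c \<in> {1..n}" "s \<in> {1..n}"
    "sparse_pattern k n b P" "compatible_entry P r c s"
  shows "real n * card (extensions k n (insert (r, c, s) P)) \<le> (1 + \<epsilon>) * card (extensions k n P)"
    and "(1 - \<epsilon>) * card (extensions k n P) \<le> real n * card (extensions k n (insert (r, c, s) P))"
proof -
  have "\<bar>real n * card (extensions k n (insert (r, c, s) P)) - card (extensions k n P)\<bar>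
      \<le> \<epsilon> * card (extensions k n P)"
    using assms unfolding nearly_uniform_entries_def by simp
  then show "real n * card (extensions k n (insert (r, c, s) P)) \<le> (1 + \<epsilon>) * card (extensions k n P)"
    and "(1 - \<epsilon>) * card (extensions k n P) \<le> real n * card (extensions k n (insert (r, c, s) P))"
    by (simp_all add: abs_le_iff distrib_right left_diff_distrib)
qed

text \<open>
  The entries are prescribed one at a time; an entry that clashes with the earlier ones leaves no
  rectangle, so the bound holds for arbitrary values on the block.
\<close>

lemma card_extensions_pattern_upper:
  assumes nu: "nearly_uniform_entries k n b \<epsilon>" and "n > 0" "0 \<le> \<epsilon>"
    and R: "R \<subseteq> {1..k}" "real (card R) \<le> b" and Q: "Q \<subseteq> {1..n}" "real (card Q) \<le> b"
    and D: "D \<subseteq> R \<times> Q" and f: "\<And>i j. (i, j) \<in> D \<Longrightarrow> f i j \<in> {1..n}"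
  shows "real (card (extensions k n (pattern_of f D)))
      \<le> ((1 + \<epsilon>) / n) ^ card D * card (latin_rectangles k n)"
proof -
  have "finite D"
    by (rule finite_subset[OF D]) (use R(1) Q(1) finite_subset in \<open>blast intro: finite_SigmaI\<close>)
  then show ?thesis using D f
  proof (induction D rule: finite_induct)
    case empty
    show ?case by (simp add: pattern_of_def extensions_empty)
  next
    case (insert x D)
    obtain r c where x: "x = (r, c)" by (cases x)
    have rc: "r \<in> {1..k}" "c \<in> {1..n}" using insert.prems(1) R(1) Q(1) x by auto
    have s: "f r c \<in> {1..n}" by (rule insert.prems(2)) (simp add: x)
    have D': "D \<subseteq> R \<times> Q" using insert.prems(1) by simp
    have f': "f i j \<in> {1..n}" if "(i, j) \<in> D" for i j
      by (rule insert.prems(2)[OF insertI2[OF that]])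
    let ?P = "pattern_of f D"
    have sp: "sparse_pattern k n b ?P" by (rule sparse_pattern_of[OF R Q D' f'])
    have pos: "0 \<le> ((1 + \<epsilon>) / n) ^ card D * card (latin_rectangles k n)" "0 \<le> (1 + \<epsilon>) / n"
      using assms by auto
    show ?case
    proof (cases "compatible_entry ?P r c (f r c)")
      case True
      then have "real n * card (extensions k n (insert (r, c, f r c) ?P)) \<le> (1 + \<epsilon>) * card (extensions k n ?P)"
        by (rule nearly_uniform_entriesD[OF nu rc s sp])
      then have "real (card (extensions k n (pattern_of f (insert x D)))) \<le> (1 + \<epsilon>) / n * card (extensions k n ?P)"
        using \<open>n > 0\<close> by (simp add: x pattern_of_insert field_simps)
      also have "\<dots> \<le> (1 + \<epsilon>) / n * (((1 + \<epsilon>) / n) ^ card D * card (latin_rectangles k n))"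
        by (rule mult_left_mono[OF insert.IH[OF D' f'] pos(2)])
      finally show ?thesis using insert.hyps by simp
    next
      case False
      have "extensions k n (insert (r, c, f r c) ?P) = {}"
        by (rule extensions_insert_incompatible[OF _ rc _ False])
          (use sp insert.hyps x in \<open>auto simp: sparse_pattern_def mem_pattern_of\<close>)
      then show ?thesis using assms by (simp add: x pattern_of_insert)
    qed
  qed
qed

lemma card_extensions_pattern_lower:
  assumes nu: "nearly_uniform_entries k n b \<epsilon>" and "n > 0" "\<epsilon> \<le> 1"
    and R: "R \<subseteq> {1..k}" "real (card R) \<le> b" and Q: "Q \<subseteq> {1..n}" "real (card Q) \<le> b"
    and D: "D \<subseteq> R \<times> Q" and f: "\<And>i j. (i, j) \<in> D \<Longrightarrow> f i j \<in> {1..n}"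
    and rows: "\<And>i j j'. (i, j) \<in> D \<Longrightarrow> (i, j') \<in> D \<Longrightarrow> f i j = f i j' \<Longrightarrow> j = j'"
    and cols: "\<And>i i' j. (i, j) \<in> D \<Longrightarrow> (i', j) \<in> D \<Longrightarrow> f i j = f i' j \<Longrightarrow> i = i'"
  shows "((1 - \<epsilon>) / n) ^ card D * card (latin_rectangles k n)
      \<le> real (card (extensions k n (pattern_of f D)))"
proof -
  have "finite D"
    by (rule finite_subset[OF D]) (use R(1) Q(1) finite_subset in \<open>blast intro: finite_SigmaI\<close>)
  then show ?thesis using D f rows cols
  proof (induction D rule: finite_induct)
    case empty
    show ?case by (simp add: pattern_of_def extensions_empty)
  next
    case (insert x D)
    obtain r c where x: "x = (r, c)" by (cases x)
    have rc: "r \<in> {1..k}" "c \<in> {1..n}" using insert.prems(1) R(1) Q(1) x by auto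
    have s: "f r c \<in> {1..n}" by (rule insert.prems(2)) (simp add: x)
    have D': "D \<subseteq> R \<times> Q" using insert.prems(1) by simp
    have f': "f i j \<in> {1..n}" if "(i, j) \<in> D" for i j
      by (rule insert.prems(2)[OF insertI2[OF that]])
    let ?P = "pattern_of f D"
    have sp: "sparse_pattern k n b ?P" by (rule sparse_pattern_of[OF R Q D' f'])
    have IH: "((1 - \<epsilon>) / n) ^ card D * card (latin_rectangles k n) \<le> real (card (extensions k n ?P))"
    proof (rule insert.IH[OF D' f'])
      show "j = j'" if "(i, j) \<in> D" "(i, j') \<in> D" "f i j = f i j'" for i j j'
        by (rule insert.prems(3)[OF insertI2[OF that(1)] insertI2[OF that(2)] that(3)])
      show "i = i'" if "(i, j) \<in> D" "(i', j) \<in> D" "f i j = f i' j" for i i' j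
        by (rule insert.prems(4)[OF insertI2[OF that(1)] insertI2[OF that(2)] that(3)])
    qed
    have rc_in: "(r, c) \<in> insert x D" and rc_notin: "(r, c) \<notin> D" using insert.hyps x by simp_all
    have "compatible_entry ?P r c (f r c)"
      unfolding compatible_entry_def mem_pattern_of
    proof (intro conjI allI notI)
      show False if "(r, c) \<in> D \<and> t = f r c" for t using rc_notin that by simp
      show False if "(r, j) \<in> D \<and> f r c = f r j" for j
      proof -
        have "c = j" by (rule insert.prems(3)[OF rc_in insertI2]) (use that in simp_all)
        then show False using that rc_notin by simp
      qed
      show False if "(i, c) \<in> D \<and> f r c = f i c" for i
      proof -
        have "r = i" by (rule insert.prems(4)[OF rc_in insertI2]) (use that in simp_all)
        then show False using that rc_notin by simp
      qed
    qed
    then have "(1 - \<epsilon>) * card (extensions k n ?P) \<le> real n * card (extensions k n (insert (r, c, f r c) ?P))"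
      by (rule nearly_uniform_entriesD[OF nu rc s sp])
    then have "(1 - \<epsilon>) / n * card (extensions k n ?P) \<le> real (card (extensions k n (pattern_of f (insert x D))))"
      using \<open>n > 0\<close> by (simp add: x pattern_of_insert field_simps)
    moreover have "(1 - \<epsilon>) / n * (((1 - \<epsilon>) / n) ^ card D * card (latin_rectangles k n))
        \<le> (1 - \<epsilon>) / n * card (extensions k n ?P)"
      by (rule mult_left_mono[OF IH]) (use assms(3) in simp)
    ultimately show ?case using insert.hyps by simp
  qed
qed

lemma card_fillings:
  assumes "finite R" "finite Q"
  shows "card (R \<rightarrow>\<^sub>E (Q \<rightarrow>\<^sub>E S)) = card S ^ (card R * card Q)"
  using assms by (simp add: card_PiE power_mult[symmetric] mult.commute)

text \<open>
  A union bound over all fillings of the block with symbols of \<open>S\<close>.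
\<close>

lemma card_confined_block:
  fixes \<epsilon> :: real
  assumes nu: "nearly_uniform_entries k n b \<epsilon>" and "n > 0" "0 \<le> \<epsilon>"
    and R: "R \<subseteq> {1..k}" "real (card R) \<le> b" and Q: "Q \<subseteq> {1..n}" "real (card Q) \<le> b"
    and S: "S \<subseteq> {1..n}"
  shows "real (card {L\<in>latin_rectangles k n. \<forall>i\<in>R. \<forall>j\<in>Q. L i j \<in> S})
      \<le> (card S * (1 + \<epsilon>) / n) ^ (card R * card Q) * card (latin_rectangles k n)"
proof -
  have fin: "finite R" "finite Q" "finite S" using R Q S finite_subset by blast+
  let ?F = "R \<rightarrow>\<^sub>E (Q \<rightarrow>\<^sub>E S)"
  have finF: "finite ?F" using fin by (intro finite_PiE)
  have "{L\<in>latin_rectangles k n. \<forall>i\<in>R. \<forall>j\<in>Q. L i j \<in> S}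
      \<subseteq> (\<Union>f\<in>?F. extensions k n (pattern_of f (R \<times> Q)))"
  proof
    fix L assume L: "L \<in> {L\<in>latin_rectangles k n. \<forall>i\<in>R. \<forall>j\<in>Q. L i j \<in> S}"
    let ?f = "\<lambda>i\<in>R. \<lambda>j\<in>Q. L i j"
    have "?f \<in> ?F" using L by auto
    moreover have "L \<in> extensions k n (pattern_of ?f (R \<times> Q))"
      using L by (auto simp: extensions_def mem_pattern_of)
    ultimately show "L \<in> (\<Union>f\<in>?F. extensions k n (pattern_of f (R \<times> Q)))" by blast
  qed
  then have "card {L\<in>latin_rectangles k n. \<forall>i\<in>R. \<forall>j\<in>Q. L i j \<in> S}
      \<le> card (\<Union>f\<in>?F. extensions k n (pattern_of f (R \<times> Q)))"
    by (rule card_mono[rotated]) (use finF finite_extensions in auto)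
  also have "\<dots> \<le> (\<Sum>f\<in>?F. card (extensions k n (pattern_of f (R \<times> Q))))"
    by (rule card_UN_le[OF finF])
  finally have "real (card {L\<in>latin_rectangles k n. \<forall>i\<in>R. \<forall>j\<in>Q. L i j \<in> S})
      \<le> (\<Sum>f\<in>?F. real (card (extensions k n (pattern_of f (R \<times> Q)))))"
    by (simp flip: of_nat_sum)
  also have "\<dots> \<le> (\<Sum>f\<in>?F. ((1 + \<epsilon>) / n) ^ card (R \<times> Q) * card (latin_rectangles k n))"
  proof (rule sum_mono)
    fix f assume f: "f \<in> ?F"
    have "f i j \<in> {1..n}" if "(i, j) \<in> R \<times> Q" for i j
      using PiE_mem[OF PiE_mem[OF f], of i j] that S by auto
    then show "real (card (extensions k n (pattern_of f (R \<times> Q))))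
        \<le> ((1 + \<epsilon>) / n) ^ card (R \<times> Q) * card (latin_rectangles k n)"
      by (intro card_extensions_pattern_upper[OF nu assms(2,3) R Q]) auto
  qed
  also have "\<dots> = (card S * (1 + \<epsilon>) / n) ^ (card R * card Q) * card (latin_rectangles k n)"
    by (simp add: card_fillings[OF fin(1,2)] card_cartesian_product power_divide power_mult_distrib)
  finally show ?thesis .
qed

section \<open>Counting Latin subsquares\<close>

definition latin_fillings :: "nat set \<Rightarrow> nat set \<Rightarrow> nat set \<Rightarrow> (nat \<Rightarrow> nat \<Rightarrow> nat) set" where
  "latin_fillings R Q S = {f \<in> R \<rightarrow>\<^sub>E (Q \<rightarrow>\<^sub>E S). is_latin_subarray f R Q S}"

text \<open>
  In particular the symbol set of a subsquare is determined by its rows and columns.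
\<close>

lemma is_latin_subarray_row_image:
  assumes "is_latin_subarray L R Q S" "finite Q" "card Q = card S" "i \<in> R"
  shows "L i ` Q = S"
proof -
  have "S \<subseteq> L i ` Q"
  proof
    fix s assume "s \<in> S"
    then have "\<exists>!j. j \<in> Q \<and> L i j = s" using assms(1,4) by (simp add: is_latin_subarray_def)
    then obtain j where "j \<in> Q" "L i j = s" by (elim ex1E conjE)
    then show "s \<in> L i ` Q" by blast
  qed
  moreover have "card (L i ` Q) \<le> card S" using card_image_le[OF assms(2), of "L i"] assms(3) by simp
  ultimately show ?thesis using card_seteq[of "L i ` Q" S] assms(2) by simp
qed

lemma is_latin_subarray_cong:
  assumes "\<And>i j. i \<in> R \<Longrightarrow> j \<in> Q \<Longrightarrow> L i j = L' i j"
  shows "is_latin_subarray L R Q S \<longleftrightarrow> is_latin_subarray L' R Q S"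
proof -
  have r: "(\<exists>!j. j \<in> Q \<and> L i j = s) = (\<exists>!j. j \<in> Q \<and> L' i j = s)" if "i \<in> R" for i s
  proof (rule arg_cong[where f = Ex1], rule ext)
    show "(j \<in> Q \<and> L i j = s) = (j \<in> Q \<and> L' i j = s)" for j
      by (cases "j \<in> Q") (simp_all add: assms[OF that])
  qed
  have c: "(\<exists>!i. i \<in> R \<and> L i j = s) = (\<exists>!i. i \<in> R \<and> L' i j = s)" if "j \<in> Q" for j s
  proof (rule arg_cong[where f = Ex1], rule ext)
    show "(i \<in> R \<and> L i j = s) = (i \<in> R \<and> L' i j = s)" for i
      by (cases "i \<in> R") (simp_all add: assms[OF _ that])
  qed
  show ?thesis
    unfolding is_latin_subarray_def by (intro conj_cong ball_cong refl r c) assumption+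
qed

lemma fillings_eq_restrict:
  assumes "f \<in> R \<rightarrow>\<^sub>E (Q \<rightarrow>\<^sub>E S)" and "\<And>i j. i \<in> R \<Longrightarrow> j \<in> Q \<Longrightarrow> L i j = f i j"
  shows "f = (\<lambda>i\<in>R. \<lambda>j\<in>Q. L i j)"
proof
  fix i
  show "f i = (\<lambda>i\<in>R. \<lambda>j\<in>Q. L i j) i"
  proof (cases "i \<in> R")
    case True
    have fi: "f i \<in> Q \<rightarrow>\<^sub>E S" by (rule PiE_mem[OF assms(1) True])
    have "f i j = (\<lambda>j\<in>Q. L i j) j" for j
      using assms(2)[OF True, of j] PiE_arb[OF fi, of j] by (cases "j \<in> Q") auto
    then show ?thesis using True by auto
  qed (use PiE_arb[OF assms(1)] in auto)
qed

lemma card_latin_on_block: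
  assumes fin: "finite R" "finite Q" "finite S" and QS: "card Q = card S"
  shows "card {L\<in>latin_rectangles k n. is_latin_subarray L R Q S}
      = (\<Sum>f\<in>latin_fillings R Q S. card (extensions k n (pattern_of f (R \<times> Q))))"
proof -
  have "{L\<in>latin_rectangles k n. is_latin_subarray L R Q S}
      = (\<Union>f\<in>latin_fillings R Q S. extensions k n (pattern_of f (R \<times> Q)))" (is "?A = ?B")
  proof (intro equalityI subsetI)
    fix L assume L: "L \<in> ?A"
    let ?f = "\<lambda>i\<in>R. \<lambda>j\<in>Q. L i j"
    have "L i j \<in> S" if "i \<in> R" "j \<in> Q" for i j
      using is_latin_subarray_row_image[OF _ fin(2) QS that(1), of L] L that(2) by blast
    then have "?f \<in> R \<rightarrow>\<^sub>E (Q \<rightarrow>\<^sub>E S)" by auto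
    moreover have "is_latin_subarray ?f R Q S \<longleftrightarrow> is_latin_subarray L R Q S"
      by (rule is_latin_subarray_cong) simp
    ultimately have "?f \<in> latin_fillings R Q S" using L by (simp add: latin_fillings_def)
    moreover have "L \<in> extensions k n (pattern_of ?f (R \<times> Q))"
      using L by (auto simp: extensions_def mem_pattern_of)
    ultimately show "L \<in> ?B" by blast
  next
    fix L assume "L \<in> ?B"
    then obtain f where f: "f \<in> latin_fillings R Q S" and L: "L \<in> extensions k n (pattern_of f (R \<times> Q))"
      by blast
    have "L i j = f i j" if "i \<in> R" "j \<in> Q" for i j
      using L that by (auto simp: extensions_def pattern_of_def)
    then have "is_latin_subarray L R Q S \<longleftrightarrow> is_latin_subarray f R Q S"
      by (rule is_latin_subarray_cong)
    then show "L \<in> ?A" using f L by (simp add: latin_fillings_def extensions_def)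
  qed
  also have "card \<dots> = (\<Sum>f\<in>latin_fillings R Q S. card (extensions k n (pattern_of f (R \<times> Q))))"
  proof (rule card_UN_disjoint)
    have "finite (R \<rightarrow>\<^sub>E (Q \<rightarrow>\<^sub>E S))" using fin by (intro finite_PiE)
    then show "finite (latin_fillings R Q S)" by (simp add: latin_fillings_def)
    show "\<forall>f\<in>latin_fillings R Q S. finite (extensions k n (pattern_of f (R \<times> Q)))"
      using finite_extensions by blast
    show "\<forall>f\<in>latin_fillings R Q S. \<forall>g\<in>latin_fillings R Q S. f \<noteq> g \<longrightarrow>
        extensions k n (pattern_of f (R \<times> Q)) \<inter> extensions k n (pattern_of g (R \<times> Q)) = {}"
    proof (intro ballI impI equals0I)
      fix f g L
      assume f: "f \<in> latin_fillings R Q S" and g: "g \<in> latin_fillings R Q S" and "f \<noteq> g"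
        and L: "L \<in> extensions k n (pattern_of f (R \<times> Q)) \<inter> extensions k n (pattern_of g (R \<times> Q))"
      have "f = (\<lambda>i\<in>R. \<lambda>j\<in>Q. L i j)"
        by (rule fillings_eq_restrict) (use f L in \<open>auto simp: latin_fillings_def extensions_def pattern_of_def\<close>)
      moreover have "g = (\<lambda>i\<in>R. \<lambda>j\<in>Q. L i j)"
        by (rule fillings_eq_restrict) (use g L in \<open>auto simp: latin_fillings_def extensions_def pattern_of_def\<close>)
      ultimately show False using \<open>f \<noteq> g\<close> by simp
    qed
  qed
  finally show ?thesis .
qed

lemma card_latin_subsquares:
  assumes "0 < m" "m < n"
  shows "card (latin_subsquares m k n L)
      = card {(R, Q, S). (R \<subseteq> {1..k} \<and> card R = m) \<and> (Q \<subseteq> {1..n} \<and> card Q = m) \<and>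
          (S \<subseteq> {1..n} \<and> card S = m) \<and> is_latin_subarray L R Q S}" (is "_ = card ?T")
proof -
  have uniq: "S = S'"
    if *: "card R = m" "finite Q" "card Q = card S" "card Q = card S'"
      "is_latin_subarray L R Q S" "is_latin_subarray L R Q S'" for R Q S S'
  proof -
    have "R \<noteq> {}" using *(1) assms(1) by auto
    then obtain i where "i \<in> R" by blast
    then show ?thesis
      using is_latin_subarray_row_image[OF *(5,2,3)] is_latin_subarray_row_image[OF *(6,2,4)]
      by simp
  qed
  have "inj_on (\<lambda>(R, Q, S). (R, Q)) ?T"
  proof (rule inj_onI)
    fix x y assume x: "x \<in> ?T" and y: "y \<in> ?T" and "(\<lambda>(R, Q, S). (R, Q)) x = (\<lambda>(R, Q, S). (R, Q)) y"
    moreover obtain R Q S where x': "x = (R, Q, S)" by (cases x)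
    moreover obtain R' Q' S' where y': "y = (R', Q', S')" by (cases y)
    ultimately have eq: "R' = R" "Q' = Q" by simp_all
    have Q: "Q \<subseteq> {1..n}" "card Q = m" and RS: "card R = m" "card S = m" "is_latin_subarray L R Q S"
      using x unfolding x' by simp_all
    have S': "card S' = m" "is_latin_subarray L R Q S'" using y unfolding y' eq by simp_all
    have "S = S'"
      by (rule uniq[OF RS(1) finite_subset[OF Q(1)] _ _ RS(3) S'(2)]) (simp_all add: Q RS S')
    then show "x = y" by (simp add: x' y' eq)
  qed
  moreover have "(\<lambda>(R, Q, S). (R, Q)) ` ?T = latin_subsquares m k n L"
  proof (intro equalityI subsetI)
    fix x assume x: "x \<in> latin_subsquares m k n L"
    obtain R Q where RQ: "x = (R, Q)" by (cases x)
    from x have "\<exists>S. (R, Q, S) \<in> ?T" by (simp add: latin_subsquares_def RQ)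
    then obtain S where "(R, Q, S) \<in> ?T" ..
    then show "x \<in> (\<lambda>(R, Q, S). (R, Q)) ` ?T"
      by (rule image_eqI[rotated]) (simp add: RQ)
  next
    fix x assume "x \<in> (\<lambda>(R, Q, S). (R, Q)) ` ?T"
    then obtain y where y: "y \<in> ?T" "x = (\<lambda>(R, Q, S). (R, Q)) y" by (rule imageE)
    obtain R Q S where RQS: "y = (R, Q, S)" by (cases y)
    have "\<exists>S. S \<subseteq> {1..n} \<and> card S = m \<and> is_latin_subarray L R Q S"
      using y(1) by (intro exI[of _ S]) (simp add: RQS)
    then show "x \<in> latin_subsquares m k n L"
      using y assms(2) by (simp add: latin_subsquares_def RQS)
  qed
  ultimately show ?thesis using card_image[of "\<lambda>(R, Q, S). (R, Q)" ?T] by simp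
qed

definition blocks :: "nat \<Rightarrow> nat \<Rightarrow> nat \<Rightarrow> (nat set \<times> nat set \<times> nat set) set" where
  "blocks m k n = {R. R \<subseteq> {1..k} \<and> card R = m} \<times> {Q. Q \<subseteq> {1..n} \<and> card Q = m} \<times> {S. S \<subseteq> {1..n} \<and> card S = m}"

lemma finite_blocks: "finite (blocks m k n)"
  by (simp add: blocks_def)

lemma card_blocks: "card (blocks m k n) = (k choose m) * (n choose m) ^ 2"
  using n_subsets[of "{1..k}" m] n_subsets[of "{1..n}" m]
  by (simp add: blocks_def card_cartesian_product power2_eq_square)

lemma sum_card_latin_subsquares:
  assumes "0 < m" "m < n"
  shows "(\<Sum>L\<in>latin_rectangles k n. card (latin_subsquares m k n L))
      = (\<Sum>(R, Q, S)\<in>blocks m k n. \<Sum>f\<in>latin_fillings R Q S. card (extensions k n (pattern_of f (R \<times> Q))))"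
proof -
  let ?A = "latin_rectangles k n"
  have "(\<Sum>L\<in>?A. card (latin_subsquares m k n L))
      = (\<Sum>L\<in>?A. card {B\<in>blocks m k n. case B of (R, Q, S) \<Rightarrow> is_latin_subarray L R Q S})"
    unfolding card_latin_subsquares[OF assms] blocks_def
    by (intro sum.cong refl arg_cong[where f = card]) auto
  also have "\<dots> = (\<Sum>L\<in>?A. \<Sum>B\<in>{B\<in>blocks m k n. case B of (R, Q, S) \<Rightarrow> is_latin_subarray L R Q S}. 1)"
    by simp
  also have "\<dots> = (\<Sum>B\<in>blocks m k n. \<Sum>L\<in>{L\<in>?A. case B of (R, Q, S) \<Rightarrow> is_latin_subarray L R Q S}. 1)"
    by (rule sum.swap_restrict) (use finite_latin_rectangles finite_blocks in auto)
  also have "\<dots> = (\<Sum>(R, Q, S)\<in>blocks m k n. card {L\<in>?A. is_latin_subarray L R Q S})"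
    by (intro sum.cong refl) auto
  also have "\<dots> = (\<Sum>(R, Q, S)\<in>blocks m k n. \<Sum>f\<in>latin_fillings R Q S. card (extensions k n (pattern_of f (R \<times> Q))))"
  proof (intro sum.cong refl, clarify)
    fix R Q S assume "(R, Q, S) \<in> blocks m k n"
    then have "finite R" "finite Q" "finite S" "card Q = card S"
      using assms(1) by (auto simp: blocks_def intro: finite_subset)
    then show "card {L\<in>?A. is_latin_subarray L R Q S}
        = (\<Sum>f\<in>latin_fillings R Q S. card (extensions k n (pattern_of f (R \<times> Q))))"
      by (rule card_latin_on_block)
  qed
  finally show ?thesis .
qed

lemma latin_subarray_iff_inj:
  assumes "finite S" "card R = card S" "card Q = card S" "finite R" "finite Q"
    and f: "f \<in> R \<rightarrow>\<^sub>E (Q \<rightarrow>\<^sub>E S)"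
  shows "is_latin_subarray f R Q S \<longleftrightarrow>
    (\<forall>i\<in>R. inj_on (f i) Q) \<and> (\<forall>j\<in>Q. inj_on (\<lambda>i. f i j) R)"
proof -
  have ex1_iff: "(\<forall>s\<in>S. \<exists>!x. x \<in> X \<and> g x = s) \<longleftrightarrow> inj_on g X"
    if X: "finite X" "card X = card S" and g: "g ` X \<subseteq> S" for g :: "nat \<Rightarrow> nat" and X
  proof
    assume *: "\<forall>s\<in>S. \<exists>!x. x \<in> X \<and> g x = s"
    show "inj_on g X"
    proof (rule inj_onI)
      fix x y assume xy: "x \<in> X" "y \<in> X" "g x = g y"
      have "\<exists>!z. z \<in> X \<and> g z = g x" using * g xy(1) by blast
      then obtain z where z: "\<forall>w. w \<in> X \<and> g w = g x \<longrightarrow> w = z" by (elim ex1E conjE)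
      have "x = z" using spec[OF z, of x] xy(1) by simp
      moreover have "y = z" using spec[OF z, of y] xy(2,3) by simp
      ultimately show "x = y" by simp
    qed
  next
    assume inj: "inj_on g X"
    have im: "g ` X = S" using card_seteq[OF assms(1) g] card_image[OF inj] X by simp
    show "\<forall>s\<in>S. \<exists>!x. x \<in> X \<and> g x = s"
    proof
      fix s assume "s \<in> S"
      then obtain x where x: "x \<in> X" "g x = s" using im by blast
      show "\<exists>!x. x \<in> X \<and> g x = s"
      proof (rule ex1I[of _ x])
        show "y = x" if "y \<in> X \<and> g y = s" for y
          using inj_onD[OF inj, of y x] that x by simp
      qed (use x in simp)
    qed
  qed
  have mem: "f i j \<in> S" if "i \<in> R" "j \<in> Q" for i j
    by (rule PiE_mem[OF PiE_mem[OF f that(1)] that(2)])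
  have "(\<forall>s\<in>S. \<exists>!j. j \<in> Q \<and> f i j = s) \<longleftrightarrow> inj_on (f i) Q" if "i \<in> R" for i
    by (rule ex1_iff[OF assms(5,3)]) (rule image_subsetI, rule mem[OF that])
  moreover have "(\<forall>s\<in>S. \<exists>!i. i \<in> R \<and> f i j = s) \<longleftrightarrow> inj_on (\<lambda>i. f i j) R" if "j \<in> Q" for j
    by (rule ex1_iff[OF assms(4,2)]) (rule image_subsetI, rule mem[OF _ that])
  ultimately show ?thesis unfolding is_latin_subarray_def by simp
qed

text \<open>
  The cyclic filling with first row \<open>xs\<close> in which each row is the previous one rotated by \<open>t\<close>.  The maps
  \<open>g\<close> and \<open>h\<close> number the rows and columns.
\<close>

definition cyclic_filling ::
    "nat set \<Rightarrow> nat set \<Rightarrow> (nat \<Rightarrow> nat) \<Rightarrow> (nat \<Rightarrow> nat) \<Rightarrow> nat list \<times> nat \<Rightarrow> nat \<Rightarrow> nat \<Rightarrow> nat" where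
  "cyclic_filling R Q g h = (\<lambda>(xs, t). \<lambda>i\<in>R. \<lambda>j\<in>Q. xs ! ((h j + t * g i) mod 3))"

lemma three_set:
  assumes "card A = 3"
  obtains a b c where "A = {a, b, c}" "a \<noteq> b" "a \<noteq> c" "b \<noteq> c"
  using assms by (auto simp: card_3_iff)

text \<open>
  A row of a Latin square of order 3 avoids the first row in every column, so it is one of the two
  rotations of the first row; the last two rows are then these two rotations in some order.
\<close>

lemma latin_square_order_3:
  assumes "distinct [a, b, c]"
    and "set [x0, x1, x2] \<subseteq> {a, b, c}" "set [y0, y1, y2] \<subseteq> {a, b, c}" "set [z0, z1, z2] \<subseteq> {a, b, c}"
    and "distinct [x0, x1, x2]" "distinct [y0, y1, y2]" "distinct [z0, z1, z2]"
    and "distinct [x0, y0, z0]" "distinct [x1, y1, z1]" "distinct [x2, y2, z2]"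
  shows "([y0, y1, y2] = [x1, x2, x0] \<and> [z0, z1, z2] = [x2, x0, x1]) \<or>
         ([y0, y1, y2] = [x2, x0, x1] \<and> [z0, z1, z2] = [x1, x2, x0])"
proof -
  have x: "{x0, x1, x2} = {a, b, c}" using assms(1,2,5) by (intro card_subset_eq) auto
  have y: "y0 \<in> {x1, x2}" "y1 \<in> {x0, x2}" "y2 \<in> {x0, x1}"
    using assms(3,8-10) unfolding x[symmetric] by auto
  have z: "z0 \<in> {x1, x2}" "z1 \<in> {x0, x2}" "z2 \<in> {x0, x1}"
    using assms(4,8-10) unfolding x[symmetric] by auto
  from y(1) consider "y0 = x1" | "y0 = x2" by blast
  then show ?thesis
  proof cases
    case 1
    then have "y2 = x0" using y(3) assms(6) by auto
    moreover from this have "y1 = x2" using y(2) assms(6) by auto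
    ultimately show ?thesis using z assms(8-10) 1 by auto
  next
    case 2
    then have "y1 = x0" using y(2) assms(6) by auto
    moreover from this have "y2 = x1" using y(3) assms(6) by auto
    ultimately show ?thesis using z assms(8-10) 2 by auto
  qed
qed

text \<open>
  There are 6 first rows and 2 directions of rotation.
\<close>

lemma card_latin_fillings_3:
  assumes R: "card R = 3" and Q: "card Q = 3" and S: "card S = 3"
  shows "card (latin_fillings R Q S) = 12"
proof -
  obtain r0 r1 r2 where r: "R = {r0, r1, r2}" "r0 \<noteq> r1" "r0 \<noteq> r2" "r1 \<noteq> r2" by (rule three_set[OF R])
  obtain q0 q1 q2 where q: "Q = {q0, q1, q2}" "q0 \<noteq> q1" "q0 \<noteq> q2" "q1 \<noteq> q2" by (rule three_set[OF Q])
  obtain a b c where s: "S = {a, b, c}" "a \<noteq> b" "a \<noteq> c" "b \<noteq> c" by (rule three_set[OF S])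
  define g where "g i = (if i = r0 then 0 else if i = r1 then 1 else 2 :: nat)" for i
  define h where "h j = (if j = q0 then 0 else if j = q1 then 1 else 2 :: nat)" for j
  have g: "g r0 = 0" "g r1 = 1" "g r2 = 2" using r by (auto simp: g_def)
  have h: "h q0 = 0" "h q1 = 1" "h q2 = 2" using q by (auto simp: h_def)
  define F where "F = cyclic_filling R Q g h"
  let ?X = "{xs. length xs = 3 \<and> distinct xs \<and> set xs \<subseteq> S}"
  have cX: "card ?X = 6"
    using card_lists_distinct_length_eq[of S 3] S s(1) by (simp add: eval_nat_numeral)
  have ev: "F ([x0, x1, x2], 1) r0 q0 = x0" "F ([x0, x1, x2], 1) r0 q1 = x1" "F ([x0, x1, x2], 1) r0 q2 = x2"
    "F ([x0, x1, x2], 1) r1 q0 = x1" "F ([x0, x1, x2], 1) r1 q1 = x2" "F ([x0, x1, x2], 1) r1 q2 = x0"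
    "F ([x0, x1, x2], 1) r2 q0 = x2" "F ([x0, x1, x2], 1) r2 q1 = x0" "F ([x0, x1, x2], 1) r2 q2 = x1"
    "F ([x0, x1, x2], 2) r0 q0 = x0" "F ([x0, x1, x2], 2) r0 q1 = x1" "F ([x0, x1, x2], 2) r0 q2 = x2"
    "F ([x0, x1, x2], 2) r1 q0 = x2" "F ([x0, x1, x2], 2) r1 q1 = x0" "F ([x0, x1, x2], 2) r1 q2 = x1"
    "F ([x0, x1, x2], 2) r2 q0 = x1" "F ([x0, x1, x2], 2) r2 q1 = x2" "F ([x0, x1, x2], 2) r2 q2 = x0"
    for x0 x1 x2
    by (simp_all add: F_def cyclic_filling_def r(1) q(1) g h)
  have list3: "\<exists>x0 x1 x2. xs = [x0, x1, x2]" if "length xs = 3" for xs :: "nat list"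
    using that by (auto simp: numeral_3_eq_3 length_Suc_conv)
  have Fext: "F p \<in> R \<rightarrow>\<^sub>E (Q \<rightarrow>\<^sub>E S)" if "p \<in> ?X \<times> {1, 2}" for p
  proof -
    obtain xs t where p: "p = (xs, t)" by (cases p)
    have "xs ! (m mod 3) \<in> S" for m
    proof -
      have "m mod 3 < length xs" using that p by simp
      then show ?thesis using that p nth_mem[of "m mod 3" xs] by auto
    qed
    then show ?thesis by (auto simp: F_def cyclic_filling_def p)
  qed
  have iff: "f \<in> latin_fillings R Q S \<longleftrightarrow> (\<forall>i\<in>R. inj_on (f i) Q) \<and> (\<forall>j\<in>Q. inj_on (\<lambda>i. f i j) R)"
    if "f \<in> R \<rightarrow>\<^sub>E (Q \<rightarrow>\<^sub>E S)" for f
    using latin_subarray_iff_inj[OF _ _ _ _ _ that] that R Q S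
    by (simp add: latin_fillings_def card_ge_0_finite)
  have inj3: "inj_on u {x, y, z} \<longleftrightarrow> distinct [u x, u y, u z]" if "x \<noteq> y" "x \<noteq> z" "y \<noteq> z"
    for u :: "nat \<Rightarrow> nat" and x y z
    using that by (auto simp: inj_on_def)
  have "F ` (?X \<times> {1, 2}) = latin_fillings R Q S"
  proof (intro equalityI subsetI)
    fix f assume "f \<in> F ` (?X \<times> {1, 2})"
    then obtain p where p: "p \<in> ?X \<times> {1, 2}" "f = F p" by (rule imageE)
    obtain xs t where pxt: "p = (xs, t)" by (cases p)
    then have xt: "p = (xs, t)" "length xs = 3" "distinct xs" "t = 1 \<or> t = 2" using p(1) by simp_all
    obtain x0 x1 x2 where x: "xs = [x0, x1, x2]" using list3[OF xt(2)] by blast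
    have d: "x0 \<noteq> x1" "x0 \<noteq> x2" "x1 \<noteq> x2" using xt(3) x by auto
    have "(\<forall>i\<in>R. inj_on (F p i) Q) \<and> (\<forall>j\<in>Q. inj_on (\<lambda>i. F p i j) R)"
      using xt(4)
    proof
      assume t: "t = 1"
      show ?thesis unfolding r(1) q(1) xt(1) x t
        by (simp only: ball_simps inj3[OF q(2-4)] inj3[OF r(2-4)] ev) (use d in \<open>auto simp: ev[unfolded One_nat_def]\<close>)
    next
      assume t: "t = 2"
      show ?thesis unfolding r(1) q(1) xt(1) x t
        by (simp only: ball_simps inj3[OF q(2-4)] inj3[OF r(2-4)] ev) (use d in \<open>auto simp: ev[unfolded One_nat_def]\<close>)
    qed
    then show "f \<in> latin_fillings R Q S" using iff[OF Fext[OF p(1)]] p(2) by simp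
  next
    fix f assume f: "f \<in> latin_fillings R Q S"
    then have fe: "f \<in> R \<rightarrow>\<^sub>E (Q \<rightarrow>\<^sub>E S)" by (simp add: latin_fillings_def)
    have mem: "f i j \<in> {a, b, c}" if "i \<in> R" "j \<in> Q" for i j
      using PiE_mem[OF PiE_mem[OF fe that(1)] that(2)] s(1) by simp
    have inj: "\<forall>i\<in>R. inj_on (f i) Q" "\<forall>j\<in>Q. inj_on (\<lambda>i. f i j) R" using f iff[OF fe] by simp_all
    have rows: "distinct [f i q0, f i q1, f i q2]" if "i \<in> R" for i
      using bspec[OF inj(1) that] unfolding q(1) inj3[OF q(2-4)] .
    have cols: "distinct [f r0 j, f r1 j, f r2 j]" if "j \<in> Q" for j
      using bspec[OF inj(2) that] unfolding r(1) inj3[OF r(2-4)] .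
    have inR: "r0 \<in> R" "r1 \<in> R" "r2 \<in> R" and inQ: "q0 \<in> Q" "q1 \<in> Q" "q2 \<in> Q" using r q by simp_all
    define xs where "xs = [f r0 q0, f r0 q1, f r0 q2]"
    have sub: "set [f i q0, f i q1, f i q2] \<subseteq> {a, b, c}" if "i \<in> R" for i
      using mem[OF that inQ(1)] mem[OF that inQ(2)] mem[OF that inQ(3)] by simp
    have xs: "xs \<in> ?X" using sub[OF inR(1)] rows[OF inR(1)] by (simp add: xs_def s(1))
    have "distinct [a, b, c]" using s by simp
    from latin_square_order_3[OF this sub[OF inR(1)] sub[OF inR(2)] sub[OF inR(3)]
        rows[OF inR(1)] rows[OF inR(2)] rows[OF inR(3)] cols[OF inQ(1)] cols[OF inQ(2)] cols[OF inQ(3)]]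
    obtain t where t: "t \<in> {1, 2}" and "\<forall>i\<in>R. \<forall>j\<in>Q. F (xs, t) i j = f i j"
    proof
      assume "[f r1 q0, f r1 q1, f r1 q2] = [f r0 q1, f r0 q2, f r0 q0] \<and>
        [f r2 q0, f r2 q1, f r2 q2] = [f r0 q2, f r0 q0, f r0 q1]"
      then have "\<forall>i\<in>R. \<forall>j\<in>Q. F (xs, 1) i j = f i j" unfolding r(1) q(1) xs_def by (simp add: ev[unfolded One_nat_def])
      then show ?thesis using that[of 1] by simp
    next
      assume "[f r1 q0, f r1 q1, f r1 q2] = [f r0 q2, f r0 q0, f r0 q1] \<and>
        [f r2 q0, f r2 q1, f r2 q2] = [f r0 q1, f r0 q2, f r0 q0]"
      then have "\<forall>i\<in>R. \<forall>j\<in>Q. F (xs, 2) i j = f i j" unfolding r(1) q(1) xs_def by (simp add: ev)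
      then show ?thesis using that[of 2] by simp
    qed
    then have "F (xs, t) i j = f i j" if "i \<in> R" "j \<in> Q" for i j using that by simp
    moreover have p: "(xs, t) \<in> ?X \<times> {1, 2}" using xs t by simp
    ultimately have "F (xs, t) = f"
      by (intro PiE_ext[OF Fext[OF p] fe] PiE_ext[OF PiE_mem[OF Fext[OF p]] PiE_mem[OF fe]])
    then have "f = F (xs, t)" by (rule sym)
    then show "f \<in> F ` (?X \<times> {1, 2})" using p by (rule image_eqI[of f F "(xs, t)"])
  qed
  moreover have "inj_on F (?X \<times> {1, 2})"
  proof (rule inj_onI)
    fix p p' assume p: "p \<in> ?X \<times> {1, 2}" and p': "p' \<in> ?X \<times> {1, 2}" and eq: "F p = F p'"
    obtain xs t where pxt: "p = (xs, t)" by (cases p)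
    then have xt: "p = (xs, t)" "length xs = 3" "distinct xs" "t = 1 \<or> t = 2" using p by simp_all
    obtain xs' t' where pxt': "p' = (xs', t')" by (cases p')
    then have xt': "p' = (xs', t')" "length xs' = 3" "distinct xs'" "t' = 1 \<or> t' = 2" using p' by simp_all
    obtain x0 x1 x2 where x: "xs = [x0, x1, x2]" using list3[OF xt(2)] by blast
    obtain y0 y1 y2 where y: "xs' = [y0, y1, y2]" using list3[OF xt'(2)] by blast
    have e: "F p r0 q0 = F p' r0 q0" "F p r0 q1 = F p' r0 q1" "F p r0 q2 = F p' r0 q2" "F p r1 q0 = F p' r1 q0"
      by (simp_all add: eq)
    have first: "F ([x0, x1, x2], t) r0 q0 = x0" "F ([x0, x1, x2], t) r0 q1 = x1" "F ([x0, x1, x2], t) r0 q2 = x2"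
      if "t = 1 \<or> t = 2" for x0 x1 x2 t
      using that by (elim disjE; simp only: ev)+
    have xs: "xs = xs'"
      using e(1-3) unfolding xt(1) xt'(1) x y first[OF xt(4)] first[OF xt'(4)] by simp
    have d: "x1 \<noteq> x2" using xt(3) x by simp
    have second: "F ([x0, x1, x2], t) r1 q0 = (if t = 1 then x1 else x2)" if "t = 1 \<or> t = 2" for t
      using that by (elim disjE) (simp_all only: ev, simp_all)
    have "(if t = 1 then x1 else x2) = (if t' = 1 then x1 else x2)"
      using e(4) unfolding xt(1) xt'(1) xs[symmetric] x second[OF xt(4)] second[OF xt'(4)] .
    then have "t = t'" using xt(4) xt'(4) d by (simp split: if_splits)
    then show "p = p'" using xs xt xt' by simp
  qed
  ultimately have "card (latin_fillings R Q S) = card (?X \<times> {1, 2 :: nat})"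
    using card_image[of F "?X \<times> {1, 2}"] by simp
  then show ?thesis by (simp add: card_cartesian_product cX)
qed

section \<open>The expected number of subsquares of order 3\<close>

text \<open>
  Linearity of expectation over the \<open>(k choose 3) * (n choose 3)\<^sup>2\<close> positions and the 12 fillings of each;
  a filling has 9 entries.
\<close>

lemma expected_order_3_subsquares:
  fixes \<epsilon> :: real
  assumes nu: "nearly_uniform_entries k n b \<epsilon>" and eps: "0 \<le> \<epsilon>" "\<epsilon> \<le> 1"
    and b: "3 \<le> b" and n: "3 < n" "k \<le> n"
  defines "E \<equiv> measure_pmf.expectation (pmf_of_set (latin_rectangles k n))
      (\<lambda>L. real (card (latin_subsquares 3 k n L)))"
    and "B \<equiv> real (12 * ((k choose 3) * (n choose 3) ^ 2))"
  shows "B * ((1 - \<epsilon>) / n) ^ 9 \<le> E" and "E \<le> B * ((1 + \<epsilon>) / n) ^ 9"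
proof -
  define N where "N = real (card (latin_rectangles k n))"
  have N: "N > 0"
    using latin_rectangles_nonempty[OF n(2)] finite_latin_rectangles by (simp add: N_def card_gt_0_iff)
  let ?x = "\<lambda>R Q f. real (card (extensions k n (pattern_of f (R \<times> Q))))"
  let ?I = "SIGMA (R, Q, S) : blocks 3 k n. latin_fillings R Q S"
  have finL: "finite (latin_fillings R Q S)" if "(R, Q, S) \<in> blocks 3 k n" for R Q S
    using that card_latin_fillings_3[of R Q S] by (intro card_ge_0_finite) (simp add: blocks_def)
  have "real (\<Sum>L\<in>latin_rectangles k n. card (latin_subsquares 3 k n L))
      = (\<Sum>B\<in>blocks 3 k n. \<Sum>f\<in>(case B of (R, Q, S) \<Rightarrow> latin_fillings R Q S). case B of (R, Q, S) \<Rightarrow> ?x R Q f)"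
    using n by (simp add: sum_card_latin_subsquares case_prod_beta)
  also have "\<dots> = (\<Sum>(B, f)\<in>?I. case B of (R, Q, S) \<Rightarrow> ?x R Q f)"
    by (rule sum.Sigma) (use finite_blocks finL in auto)
  finally have tot: "real (\<Sum>L\<in>latin_rectangles k n. card (latin_subsquares 3 k n L))
      = (\<Sum>(B, f)\<in>?I. case B of (R, Q, S) \<Rightarrow> ?x R Q f)" .
  have "E = real (\<Sum>L\<in>latin_rectangles k n. card (latin_subsquares 3 k n L)) / N"
    unfolding E_def N_def
    by (simp add: integral_pmf_of_set[OF latin_rectangles_nonempty[OF n(2)] finite_latin_rectangles])
  then have E: "E = (\<Sum>(B, f)\<in>?I. case B of (R, Q, S) \<Rightarrow> ?x R Q f) / N" by (simp only: tot)
  have "card ?I = (\<Sum>B\<in>blocks 3 k n. card (case B of (R, Q, S) \<Rightarrow> latin_fillings R Q S))"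
    by (rule card_SigmaI) (use finite_blocks finL in auto)
  also have "\<dots> = (\<Sum>B\<in>blocks 3 k n. 12)"
    by (intro sum.cong refl) (auto simp: blocks_def card_latin_fillings_3)
  finally have cI: "real (card ?I) = B" by (simp add: card_blocks B_def)
  have main: "((1 - \<epsilon>) / n) ^ 9 * N \<le> ?x R Q f \<and> ?x R Q f \<le> ((1 + \<epsilon>) / n) ^ 9 * N"
    if "((R, Q, S), f) \<in> ?I" for R Q S f
  proof -
    from that have RQS: "(R, Q, S) \<in> blocks 3 k n" and f: "f \<in> latin_fillings R Q S" by simp_all
    from RQS have R: "R \<subseteq> {1..k}" "card R = 3" and Q: "Q \<subseteq> {1..n}" "card Q = 3"
      and S: "S \<subseteq> {1..n}" "card S = 3" by (simp_all add: blocks_def)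
    have fin: "finite R" "finite Q" "finite S" using R Q S by (simp_all add: card_ge_0_finite)
    have fP: "f \<in> R \<rightarrow>\<^sub>E (Q \<rightarrow>\<^sub>E S)" using f by (simp add: latin_fillings_def)
    have inj: "(\<forall>i\<in>R. inj_on (f i) Q) \<and> (\<forall>j\<in>Q. inj_on (\<lambda>i. f i j) R)"
      using latin_subarray_iff_inj[OF fin(3) _ _ fin(1,2) fP] f R Q S by (simp add: latin_fillings_def)
    have mem: "f i j \<in> {1..n}" if "(i, j) \<in> R \<times> Q" for i j
      using PiE_mem[OF PiE_mem[OF fP], of i j] that S(1) by auto
    have rb: "real (card R) \<le> b" "real (card Q) \<le> b" using R Q b by simp_all
    have c9: "card (R \<times> Q) = 9" using R Q by (simp add: card_cartesian_product)
    have "((1 - \<epsilon>) / n) ^ card (R \<times> Q) * N \<le> ?x R Q f"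
      unfolding N_def
    proof (rule card_extensions_pattern_lower[OF nu _ eps(2) R(1) rb(1) Q(1) rb(2) order_refl mem])
      show "j = j'" if "(i, j) \<in> R \<times> Q" "(i, j') \<in> R \<times> Q" "f i j = f i j'" for i j j'
        by (rule inj_onD[of "f i" Q]) (use inj that in simp_all)
      show "i = i'" if "(i, j) \<in> R \<times> Q" "(i', j) \<in> R \<times> Q" "f i j = f i' j" for i i' j
        by (rule inj_onD[of "\<lambda>i. f i j" R]) (use inj that in simp_all)
    qed (use n in simp_all)
    moreover have "?x R Q f \<le> ((1 + \<epsilon>) / n) ^ card (R \<times> Q) * N"
      unfolding N_def
      by (rule card_extensions_pattern_upper[OF nu _ eps(1) R(1) rb(1) Q(1) rb(2) order_refl mem])
        (use n in simp_all)
    ultimately show ?thesis by (simp only: c9)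
  qed
  have "(\<Sum>p\<in>?I. ((1 - \<epsilon>) / n) ^ 9 * N) \<le> (\<Sum>(B, f)\<in>?I. case B of (R, Q, S) \<Rightarrow> ?x R Q f)"
    by (rule sum_mono) (use main in \<open>force split: prod.splits\<close>)
  then have "B * ((1 - \<epsilon>) / n) ^ 9 * N \<le> E * N"
    using N by (simp add: E cI mult.assoc)
  then show "B * ((1 - \<epsilon>) / n) ^ 9 \<le> E" using N by simp
  have "(\<Sum>(B, f)\<in>?I. case B of (R, Q, S) \<Rightarrow> ?x R Q f) \<le> (\<Sum>p\<in>?I. ((1 + \<epsilon>) / n) ^ 9 * N)"
    by (rule sum_mono) (use main in \<open>force split: prod.splits\<close>)
  then have "E * N \<le> B * ((1 + \<epsilon>) / n) ^ 9 * N"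
    using N by (simp add: E cI mult.assoc)
  then show "E \<le> B * ((1 + \<epsilon>) / n) ^ 9" using N by simp
qed

lemma choose_3_asymp:
  assumes "n \<ge> 3"
  shows "1 - 3 / real n \<le> real (n choose 3) * 6 / n ^ 3" "real (n choose 3) * 6 / n ^ 3 \<le> 1"
proof -
  have "real (n choose 3) = real n * (real n - 1) * (real n - 2) / 6"
    using binomial_gbinomial[of n 3, where 'a = real] by (simp add: gbinomial_prod_rev numeral_3_eq_3 field_simps)
  then have e: "real (n choose 3) * 6 = real n * (real n - 1) * (real n - 2)" by simp
  have n: "real n > 0" using assms by simp
  have "(1 - 3 / real n) * n ^ 3 \<le> real (n choose 3) * 6"
    unfolding e using n by (simp add: power3_eq_cube algebra_simps)
  then show "1 - 3 / real n \<le> real (n choose 3) * 6 / n ^ 3" using n by (simp add: pos_le_divide_eq)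
  have "real (n choose 3) * fact 3 \<le> real n ^ 3"
    using binomial_fact_pow[of n 3] by (metis of_nat_fact of_nat_le_iff of_nat_mult of_nat_power)
  then show "real (n choose 3) * 6 / n ^ 3 \<le> 1" using n by (simp add: divide_le_eq fact_numeral)
qed

lemma ninth_power_bounds:
  fixes \<epsilon> :: real
  assumes "0 \<le> \<epsilon>" "\<epsilon> \<le> 1"
  shows "(1 + \<epsilon> / 20) ^ 9 \<le> 1 + \<epsilon>" "1 - \<epsilon> / 2 \<le> (1 - \<epsilon> / 20) ^ 9"
proof -
  have "(1 + \<epsilon> / 20) ^ 9 \<le> exp (\<epsilon> / 20) ^ 9"
    by (rule power_mono) (use assms exp_ge_add_one_self[of "\<epsilon> / 20"] in auto)
  also have "\<dots> = exp (9 / 20 * \<epsilon>)" by (simp flip: exp_of_nat_mult)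
  also have "\<dots> \<le> 1 + 9 / 20 * \<epsilon> + (9 / 20 * \<epsilon>)\<^sup>2" by (rule exp_bound) (use assms in auto)
  also have "\<dots> \<le> 1 + \<epsilon>"
  proof -
    have "\<epsilon> * \<epsilon> \<le> \<epsilon>" using assms by (simp add: mult_left_le)
    then show ?thesis using assms by (simp add: power2_eq_square)
  qed
  finally show "(1 + \<epsilon> / 20) ^ 9 \<le> 1 + \<epsilon>" .
  have "1 + real 9 * (- \<epsilon> / 20) \<le> (1 + (- \<epsilon> / 20)) ^ 9"
    by (rule Bernoulli_inequality) (use assms in simp)
  then show "1 - \<epsilon> / 2 \<le> (1 - \<epsilon> / 20) ^ 9" using assms by simp
qed

text \<open>
  The main term is \<open>12 * (k choose 3) * (n choose 3)\<^sup>2 / n ^ 9\<close>, and \<open>n choose 3\<close> is about \<open>n ^ 3 / 6\<close>.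
\<close>

lemma expected_order_3_subsquares_asymp:
  fixes \<epsilon> :: real
  assumes nu: "nearly_uniform_entries k n b (\<epsilon> / 20)" and eps: "0 < \<epsilon>" "\<epsilon> \<le> 1"
    and b: "3 \<le> b" and n: "24 / \<epsilon> \<le> n" "k \<le> n"
  shows "measure_pmf.expectation (pmf_of_set (latin_rectangles k n))
      (\<lambda>L. real (card (latin_subsquares 3 k n L)))
    \<in> {(1 - \<epsilon>) * (real (k choose 3) / (3 * real n ^ 3)) .. (1 + \<epsilon>) * (real (k choose 3) / (3 * real n ^ 3))}"
proof -
  define q where "q = real (n choose 3) * 6 / n ^ 3"
  define M where "M = real (k choose 3) / (3 * real n ^ 3)"
  have "24 \<le> 24 / \<epsilon>" using eps by (simp add: le_divide_eq)
  then have n24: "n \<ge> 24" using n(1) by linarith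
  have M: "M \<ge> 0" by (simp add: M_def)
  have "3 / real n \<le> \<epsilon> / 8" using n(1) eps n24 by (simp add: field_simps)
  then have q: "1 - \<epsilon> / 8 \<le> q" "q \<le> 1"
    using choose_3_asymp[of n] n24 unfolding q_def by linarith+
  have id: "real (12 * ((k choose 3) * (n choose 3) ^ 2)) * (x / n) ^ 9 = M * (q\<^sup>2 * x ^ 9)" for x :: real
  proof -
    have "real n ^ 9 = real n ^ 3 * (real n ^ 3)\<^sup>2" by (simp flip: power_mult power_add)
    then show ?thesis using n24
      by (simp add: M_def q_def power_divide power_mult_distrib field_simps)
  qed
  note E = expected_order_3_subsquares[OF nu _ _ b _ n(2), unfolded id]
  have "q\<^sup>2 * (1 + \<epsilon> / 20) ^ 9 \<le> 1 * (1 + \<epsilon>)"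
    using q eps by (intro mult_mono ninth_power_bounds power_le_one) auto
  then have up: "M * (q\<^sup>2 * (1 + \<epsilon> / 20) ^ 9) \<le> M * (1 + \<epsilon>)"
    by (intro mult_left_mono M) simp
  have "1 - \<epsilon> \<le> (1 - \<epsilon> / 8)\<^sup>2 * (1 - \<epsilon> / 2)"
  proof -
    have "(1 - \<epsilon> / 4) * (1 - \<epsilon> / 2) \<le> (1 - \<epsilon> / 8)\<^sup>2 * (1 - \<epsilon> / 2)"
      using eps by (intro mult_right_mono) (simp_all add: power2_eq_square algebra_simps)
    moreover have "1 - \<epsilon> \<le> (1 - \<epsilon> / 4) * (1 - \<epsilon> / 2)" using eps by (simp add: algebra_simps)
    ultimately show ?thesis by linarith
  qed
  also have "\<dots> \<le> q\<^sup>2 * (1 - \<epsilon> / 20) ^ 9"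
    using q eps by (intro mult_mono ninth_power_bounds power_mono) auto
  finally have lo: "M * (1 - \<epsilon>) \<le> M * (q\<^sup>2 * (1 - \<epsilon> / 20) ^ 9)"
    by (rule mult_left_mono[OF _ M])
  show ?thesis
    using E(1) E(2) up lo eps n24 unfolding M_def[symmetric] by (auto simp: mult.commute[of M])
qed

section \<open>The probability of a larger subsquare\<close>

definition confined :: "nat \<Rightarrow> nat \<Rightarrow> nat set \<times> nat set \<times> nat set \<Rightarrow> (nat \<Rightarrow> nat \<Rightarrow> nat) set" where
  "confined k n = (\<lambda>(R, Q, S). {L\<in>latin_rectangles k n. \<forall>i\<in>R. \<forall>j\<in>Q. L i j \<in> S})"

lemma finite_confined: "finite (confined k n B)"
  using finite_latin_rectangles by (simp add: confined_def case_prod_beta)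

text \<open>
  For a subsquare of order greater than \<open>b\<close> only a \<open>b\<close> by \<open>b\<close> part of it is used, since the pattern has
  to stay sparse.  The symbols of that part still lie in the symbol set of the whole subsquare, which has
  at most \<open>k\<close> elements.
\<close>

definition wide_blocks :: "nat \<Rightarrow> nat \<Rightarrow> nat \<Rightarrow> (nat set \<times> nat set \<times> nat set) set" where
  "wide_blocks b k n =
     {R. R \<subseteq> {1..k} \<and> card R = b} \<times> {Q. Q \<subseteq> {1..n} \<and> card Q = b} \<times> {S. S \<subseteq> {1..n} \<and> card S \<le> k}"

lemma card_wide_blocks:
  assumes "k \<le> n"
  shows "finite (wide_blocks b k n)" "card (wide_blocks b k n) \<le> 8 ^ n"
proof -
  show "finite (wide_blocks b k n)" by (simp add: wide_blocks_def)
  have "wide_blocks b k n \<subseteq> Pow {1..n} \<times> Pow {1..n} \<times> Pow {1..n}"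
    using assms by (fastforce simp: wide_blocks_def)
  then have "card (wide_blocks b k n) \<le> card (Pow {1..n} \<times> Pow {1..n} \<times> Pow {1..n})"
    by (rule card_mono[rotated]) simp
  also have "\<dots> = 8 ^ n" by (simp add: card_cartesian_product card_Pow flip: power_mult_distrib)
  finally show "card (wide_blocks b k n) \<le> 8 ^ n" .
qed

lemma large_subsquare_confined:
  assumes L: "L \<in> latin_rectangles k n" and m: "m > 3" "latin_subsquares m k n L \<noteq> {}"
  shows "(\<exists>m\<in>{4..b}. \<exists>B\<in>blocks m k n. L \<in> confined k n B) \<or> (\<exists>B\<in>wide_blocks b k n. L \<in> confined k n B)"
proof -
  obtain RQ where "RQ \<in> latin_subsquares m k n L" using m(2) by blast
  moreover obtain R Q where "RQ = (R, Q)" by (cases RQ)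
  ultimately have RQ: "R \<subseteq> {1..k}" "card R = m" "Q \<subseteq> {1..n}" "card Q = m"
    and "\<exists>S. S \<subseteq> {1..n} \<and> card S = m \<and> is_latin_subarray L R Q S"
    by (simp_all add: latin_subsquares_def)
  then obtain S where S: "S \<subseteq> {1..n}" "card S = m" "is_latin_subarray L R Q S" by (elim exE conjE)
  have fin: "finite R" "finite Q" using RQ m(1) by (simp_all add: card_ge_0_finite)
  have "card Q = card S" using RQ(4) S(2) by simp
  then have mem: "L i j \<in> S" if "i \<in> R" "j \<in> Q" for i j
    using is_latin_subarray_row_image[OF S(3) fin(2) _ that(1)] that(2) by blast
  show ?thesis
  proof (cases "m \<le> b")
    case True
    have "(R, Q, S) \<in> blocks m k n" using RQ S by (simp add: blocks_def)
    moreover have "L \<in> confined k n (R, Q, S)" using L mem by (simp add: confined_def)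
    moreover have "m \<in> {4..b}" using m(1) True by simp
    ultimately show ?thesis by blast
  next
    case False
    obtain R' where R': "R' \<subseteq> R" "card R' = b" using obtain_subset_with_card_n[of b R] False RQ by auto
    obtain Q' where Q': "Q' \<subseteq> Q" "card Q' = b" using obtain_subset_with_card_n[of b Q] False RQ by auto
    have "m \<le> k" using card_mono[OF _ RQ(1)] RQ(2) by simp
    then have "(R', Q', S) \<in> wide_blocks b k n"
      using RQ R' Q' S by (auto simp: wide_blocks_def)
    moreover have "L \<in> confined k n (R', Q', S)" using L mem R' Q' by (auto simp: confined_def)
    ultimately show ?thesis by blast
  qed
qed

lemma card_blocks_le:
  assumes "k \<le> n"
  shows "card (blocks m k n) \<le> n ^ (3 * m)"
proof -
  have ch: "n choose m \<le> n ^ m"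
  proof -
    have "n choose m \<le> (n choose m) * fact m" by (simp add: fact_ge_1)
    then show ?thesis using binomial_fact_pow[of n m] by linarith
  qed
  have "card (blocks m k n) \<le> n ^ m * (n ^ m) ^ 2"
    unfolding card_blocks
    by (intro mult_mono power_mono ch order_trans[OF binomial_right_mono[OF assms] ch]) simp_all
  also have "\<dots> = n ^ (3 * m)" by (simp flip: power_mult power_add)
  finally show ?thesis .
qed

text \<open>
  The factor from \<open>m\<close> to \<open>m + 1\<close> is at most \<open>2 (m + 1) / n\<close> times \<open>(1 + 1/m) ^ m \<le> 3\<close>.
\<close>

lemma power_ratio_decreasing:
  assumes "5 \<le> m" "6 * m \<le> n"
  shows "(2 * real m / n) ^ m \<le> (10 / real n) ^ 5"
  using assms
proof (induction m rule: dec_induct)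
  case base
  then show ?case by simp
next
  case (step m)
  have n: "real n > 0" using step by simp
  have m: "real m > 0" using step by simp
  have "(1 + 1 / real m) ^ m \<le> exp (1 / real m) ^ m"
    by (rule power_mono) (use exp_ge_add_one_self[of "1 / real m"] in auto)
  also have "\<dots> = exp 1" using m by (simp flip: exp_of_nat_mult)
  also have "\<dots> \<le> 3" by (rule exp_le)
  finally have e: "(1 + 1 / real m) ^ m \<le> 3" .
  have split: "2 * real (Suc m) / n = (1 + 1 / real m) * (2 * real m / n)"
    using m n by (simp add: field_simps)
  have "(2 * real (Suc m) / n) ^ Suc m = (2 * real (Suc m) / n) * ((1 + 1 / real m) ^ m * (2 * real m / n) ^ m)"
    by (simp only: power_Suc) (simp only: split power_mult_distrib)
  also have "\<dots> \<le> (2 * real (Suc m) / n) * (3 * (2 * real m / n) ^ m)"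
    by (intro mult_left_mono mult_right_mono e) auto
  also have "\<dots> = (6 * real (Suc m) / n) * (2 * real m / n) ^ m" by simp
  also have "\<dots> \<le> 1 * (2 * real m / n) ^ m"
    by (rule mult_right_mono) (use step.prems n in \<open>auto simp: divide_le_eq\<close>)
  also have "\<dots> \<le> (10 / real n) ^ 5" using step by simp
  finally show ?case .
qed

lemma fourth_power_le_two_power:
  assumes "16 \<le> (n::nat)"
  shows "n ^ 4 \<le> 2 ^ n"
  using assms
proof (induction n rule: dec_induct)
  case base
  then show ?case by simp
next
  case (step n)
  have "16 * n ^ 3 \<le> n * n ^ 3" using step by simp
  moreover have "n * n ^ 3 = n ^ 4" by (simp add: eval_nat_numeral)
  moreover have "n ^ 2 * 6 \<le> 6 * n ^ 3" "4 * n \<le> 4 * n ^ 3" "1 \<le> n ^ 3"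
    using step by (auto simp: power_increasing self_le_power)
  moreover have "Suc n ^ 4 = n ^ 4 + 4 * n ^ 3 + n ^ 2 * 6 + 4 * n + 1"
    by (simp add: eval_nat_numeral algebra_simps)
  ultimately have "Suc n ^ 4 \<le> 2 * n ^ 4" by linarith
  then show ?case using step by simp
qed

text \<open>
  A union bound in three ranges of the order \<open>m\<close>, each entry of a pattern having probability at most
  \<open>(3/2) / n\<close>.  For \<open>m \<le> b\<close> the expected number of positions is at most
  \<open>n ^ (3 m) (3 m / (2 n)) ^ (m * m)\<close>: this is \<open>6 ^ 16 / n ^ 4\<close> for \<open>m = 4\<close>, and \<open>O(1 / n ^ 6)\<close> uniformly for
  \<open>m \<ge> 5\<close>.  For \<open>m > b\<close> there are at most \<open>8 ^ n\<close> positions, and the symbol set has at most \<open>n / 2\<close>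
  elements, so all \<open>b * b\<close> entries fall into it with probability at most \<open>(3/4) ^ (b * b)\<close>, where \<open>b * b\<close>
  is at least \<open>10 n\<close>.
\<close>

lemma prob_large_subsquare:
  assumes nu: "nearly_uniform_entries k n c (1/2)" and kn: "2 * k \<le> n"
    and b: "real b \<le> c" "4 \<le> b" "12 * b \<le> n" "10 * n \<le> b * b" and n: "10 ^ 15 \<le> n"
  shows "measure_pmf.prob (pmf_of_set (latin_rectangles k n))
      {L. \<exists>m>3. latin_subsquares m k n L \<noteq> {}} \<le> (6 ^ 16 + 2) / real n ^ 4"
proof -
  define N where "N = real (card (latin_rectangles k n))"
  have k_n: "k \<le> n" using kn by simp
  have n0: "real n > 0" using n by simp
  have N: "N > 0"
    using latin_rectangles_nonempty[OF k_n] finite_latin_rectangles by (simp add: N_def card_gt_0_iff)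
  have conf: "real (card (confined k n (R, Q, S))) \<le> (3 / 2 * card S / n) ^ (card R * card Q) * N"
    if "R \<subseteq> {1..k}" "card R \<le> b" "Q \<subseteq> {1..n}" "card Q \<le> b" "S \<subseteq> {1..n}" for R Q S
  proof -
    have "real (card {L\<in>latin_rectangles k n. \<forall>i\<in>R. \<forall>j\<in>Q. L i j \<in> S})
        \<le> (card S * (1 + 1/2) / n) ^ (card R * card Q) * card (latin_rectangles k n)"
      by (rule card_confined_block[OF nu]) (use that b(1) n0 in auto)
    then show ?thesis by (simp add: confined_def N_def mult.commute)
  qed
  let ?A = "\<Union>m\<in>{4..b}. \<Union>B\<in>blocks m k n. confined k n B"
  let ?W = "\<Union>B\<in>wide_blocks b k n. confined k n B"
  have "latin_rectangles k n \<inter> {L. \<exists>m>3. latin_subsquares m k n L \<noteq> {}} \<subseteq> ?A \<union> ?W"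
  proof
    fix L assume "L \<in> latin_rectangles k n \<inter> {L. \<exists>m>3. latin_subsquares m k n L \<noteq> {}}"
    then obtain m where "L \<in> latin_rectangles k n" "m > 3" "latin_subsquares m k n L \<noteq> {}" by blast
    from large_subsquare_confined[OF this, of b] show "L \<in> ?A \<union> ?W" by blast
  qed
  then have "card (latin_rectangles k n \<inter> {L. \<exists>m>3. latin_subsquares m k n L \<noteq> {}}) \<le> card (?A \<union> ?W)"
    by (rule card_mono[rotated]) (use finite_confined finite_blocks card_wide_blocks(1)[OF k_n] in auto)
  also have "\<dots> \<le> card ?A + card ?W" by (rule card_Un_le)
  finally have total: "real (card (latin_rectangles k n \<inter> {L. \<exists>m>3. latin_subsquares m k n L \<noteq> {}}))
      \<le> real (card ?A) + real (card ?W)" by linarith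
  have term_m: "real (card (\<Union>B\<in>blocks m k n. confined k n B)) \<le> (real n ^ 3 * (3 / 2 * m / n) ^ m) ^ m * N"
    if m: "m \<le> b" for m
  proof -
    have "card (\<Union>B\<in>blocks m k n. confined k n B) \<le> (\<Sum>B\<in>blocks m k n. card (confined k n B))"
      by (rule card_UN_le[OF finite_blocks])
    then have "real (card (\<Union>B\<in>blocks m k n. confined k n B)) \<le> (\<Sum>B\<in>blocks m k n. real (card (confined k n B)))"
      by (simp flip: of_nat_sum)
    also have "\<dots> \<le> (\<Sum>B\<in>blocks m k n. (3 / 2 * m / n) ^ (m * m) * N)"
    proof (rule sum_mono)
      fix B assume B: "B \<in> blocks m k n"
      obtain R Q S where RQS: "B = (R, Q, S)" by (cases B)
      show "real (card (confined k n B)) \<le> (3 / 2 * m / n) ^ (m * m) * N"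
        using conf[of R Q S] B m by (simp add: blocks_def RQS)
    qed
    also have "\<dots> = real (card (blocks m k n)) * ((3 / 2 * m / n) ^ (m * m) * N)" by simp
    also have "\<dots> \<le> real n ^ (3 * m) * ((3 / 2 * m / n) ^ (m * m) * N)"
    proof (rule mult_right_mono)
      show "real (card (blocks m k n)) \<le> real n ^ (3 * m)"
        using card_blocks_le[OF k_n, of m] by (metis of_nat_le_iff of_nat_power)
    qed (use N in simp)
    also have "\<dots> = (real n ^ 3 * (3 / 2 * m / n) ^ m) ^ m * N"
      by (simp only: power_mult power_mult_distrib mult.assoc)
    finally show ?thesis .
  qed
  have "real (card (\<Union>B\<in>blocks 4 k n. confined k n B)) \<le> (real n ^ 3 * (3 / 2 * real 4 / n) ^ 4) ^ 4 * N"
    by (rule term_m) (rule b(2))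
  also have "(real n ^ 3 * (3 / 2 * real 4 / n) ^ 4) ^ 4 = 6 ^ 16 / real n ^ 4"
    using n0 by (simp add: power_divide power_mult_distrib field_simps flip: power_mult power_add)
  finally have T4: "real (card (\<Union>B\<in>blocks 4 k n. confined k n B)) \<le> 6 ^ 16 / real n ^ 4 * N" .
  have Tm: "real (card (\<Union>B\<in>blocks m k n. confined k n B)) \<le> 1 / real n ^ 5 * N" if m: "m \<in> {5..b}" for m
  proof -
    have n1: "1 \<le> real n" using n0 by simp
    have "real n ^ 3 * (3 / 2 * m / n) ^ m \<le> real n ^ 3 * (10 / real n) ^ 5"
    proof (rule mult_left_mono)
      have "(3 / 2 * m / n) ^ m \<le> (2 * real m / n) ^ m"
        by (intro power_mono divide_right_mono mult_right_mono) auto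
      also have "\<dots> \<le> (10 / real n) ^ 5"
        by (rule power_ratio_decreasing) (use m b(3) in auto)
      finally show "(3 / 2 * m / n) ^ m \<le> (10 / real n) ^ 5" .
    qed simp
    also have "real n ^ 3 * (10 / real n) ^ 5 = 10 ^ 5 / real n ^ 2"
      using n0 by (simp add: power_divide field_simps flip: power_add)
    finally have u: "real n ^ 3 * (3 / 2 * m / n) ^ m \<le> 10 ^ 5 / real n ^ 2" .
    have "(10::real) ^ 5 \<le> real n ^ 1" using n by simp
    also have "\<dots> \<le> real n ^ 2" by (rule power_increasing) (use n1 in auto)
    finally have u1: "10 ^ 5 / real n ^ 2 \<le> 1" using n0 by (simp add: divide_le_eq)
    have "(real n ^ 3 * (3 / 2 * m / n) ^ m) ^ m \<le> (10 ^ 5 / real n ^ 2) ^ m"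
      by (rule power_mono[OF u]) simp
    also have "\<dots> \<le> (10 ^ 5 / real n ^ 2) ^ 3"
      by (rule power_decreasing) (use m u1 in auto)
    also have "\<dots> = 10 ^ 15 / real n ^ 6" by (simp add: power_divide flip: power_mult)
    \<comment> \<open>One factor \<open>1 / n\<close> beyond the claimed order is kept for the sum over \<open>m\<close>.\<close>
    also have "\<dots> \<le> real n / real n ^ 6"
      by (rule divide_right_mono) (use n in simp_all)
    also have "\<dots> = 1 / real n ^ 5" using n0 by (simp add: eval_nat_numeral)
    finally have "(real n ^ 3 * (3 / 2 * m / n) ^ m) ^ m * N \<le> 1 / real n ^ 5 * N"
      by (rule mult_right_mono) (use N in simp)
    then show ?thesis using term_m[of m] m by simp
  qed
  have "{4..b} = insert 4 {5..b}" using b(2) by auto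
  then have "card ?A \<le> card (\<Union>B\<in>blocks 4 k n. confined k n B) + card (\<Union>m\<in>{5..b}. \<Union>B\<in>blocks m k n. confined k n B)"
    by (simp add: card_Un_le)
  also have "card (\<Union>m\<in>{5..b}. \<Union>B\<in>blocks m k n. confined k n B)
      \<le> (\<Sum>m\<in>{5..b}. card (\<Union>B\<in>blocks m k n. confined k n B))" by (rule card_UN_le) simp
  finally have "real (card ?A) \<le> real (card (\<Union>B\<in>blocks 4 k n. confined k n B))
      + (\<Sum>m\<in>{5..b}. real (card (\<Union>B\<in>blocks m k n. confined k n B)))"
    by (simp flip: of_nat_sum of_nat_add)
  also have "\<dots> \<le> 6 ^ 16 / real n ^ 4 * N + (\<Sum>m\<in>{5..b}. 1 / real n ^ 5 * N)"
    by (intro add_mono T4 sum_mono Tm)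
  also have "(\<Sum>m\<in>{5..b}. 1 / real n ^ 5 * N) \<le> 1 / real n ^ 4 * N"
  proof -
    have "real (card {5..b}) * (1 / real n ^ 5 * N) \<le> real n * (1 / real n ^ 5 * N)"
      by (rule mult_right_mono) (use b(3) N in auto)
    also have "\<dots> = 1 / real n ^ 4 * N" using n0 by (simp add: eval_nat_numeral)
    finally show ?thesis by simp
  qed
  finally have A: "real (card ?A) \<le> 6 ^ 16 / real n ^ 4 * N + 1 / real n ^ 4 * N" by simp
  have "card ?W \<le> (\<Sum>B\<in>wide_blocks b k n. card (confined k n B))"
    by (rule card_UN_le[OF card_wide_blocks(1)[OF k_n]])
  then have "real (card ?W) \<le> (\<Sum>B\<in>wide_blocks b k n. real (card (confined k n B)))"
    by (simp flip: of_nat_sum)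
  also have "\<dots> \<le> (\<Sum>B\<in>wide_blocks b k n. (3 / 4) ^ (b * b) * N)"
  proof (rule sum_mono)
    fix B assume B: "B \<in> wide_blocks b k n"
    obtain R Q S where RQS: "B = (R, Q, S)" by (cases B)
    have S: "card S \<le> k" and "real (card (confined k n (R, Q, S))) \<le> (3 / 2 * card S / n) ^ (b * b) * N"
      using conf[of R Q S] B by (simp_all add: wide_blocks_def RQS)
    note this(2)
    also have "(3 / 2 * card S / n) ^ (b * b) * N \<le> (3 / 4) ^ (b * b) * N"
    proof (intro mult_right_mono power_mono)
      have "2 * real (card S) \<le> n" using S kn by linarith
      then show "3 / 2 * card S / n \<le> 3 / 4" using n0 by (simp add: divide_le_eq)
    qed (use N in auto)
    finally show "real (card (confined k n B)) \<le> (3 / 4) ^ (b * b) * N" by (simp add: RQS)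
  qed
  also have "\<dots> = real (card (wide_blocks b k n)) * ((3 / 4) ^ (b * b) * N)" by simp
  also have "\<dots> \<le> 8 ^ n * ((1 / 16) ^ n * N)"
  proof (intro mult_mono mult_right_mono)
    show "real (card (wide_blocks b k n)) \<le> 8 ^ n"
      using card_wide_blocks(2)[OF k_n, of b] by (metis of_nat_le_iff of_nat_numeral of_nat_power)
    have "(3 / 4 :: real) ^ (b * b) \<le> (3 / 4) ^ (10 * n)" by (rule power_decreasing) (use b(4) in auto)
    also have "\<dots> = ((3 / 4) ^ 10) ^ n" by (rule power_mult)
    also have "\<dots> \<le> (1 / 16) ^ n" by (rule power_mono) (auto simp: power_divide)
    finally show "(3 / 4 :: real) ^ (b * b) \<le> (1 / 16) ^ n" .
  qed (use N in auto)
  also have "\<dots> = 1 / 2 ^ n * N"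
  proof -
    have "(8::real) ^ n * (1 / 16) ^ n = (1 / 2) ^ n" by (simp flip: power_mult_distrib)
    then show ?thesis by (simp only: power_divide power_one flip: mult.assoc)
  qed
  also have "\<dots> \<le> 1 / real n ^ 4 * N"
  proof (rule mult_right_mono)
    have "real (n ^ 4) \<le> real (2 ^ n)"
      by (rule of_nat_mono, rule fourth_power_le_two_power) (use n in simp)
    then show "1 / 2 ^ n \<le> 1 / real n ^ 4" using n0 by (intro divide_left_mono) auto
  qed (use N in simp)
  finally have W: "real (card ?W) \<le> 1 / real n ^ 4 * N" .
  have "real (card (latin_rectangles k n \<inter> {L. \<exists>m>3. latin_subsquares m k n L \<noteq> {}}))
      \<le> (6 ^ 16 + 2) / real n ^ 4 * N"
    using total A W by (simp add: add_divide_distrib distrib_right)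
  then show ?thesis
    using N unfolding measure_pmf_of_set[OF latin_rectangles_nonempty[OF k_n] finite_latin_rectangles] N_def
    by (simp add: divide_le_eq)
qed

section \<open>Subsquares of a random Latin rectangle\<close>

theorem theorem1p4:
  "\<exists>C::real. C > 0 \<and>
     (\<forall>\<epsilon>::real. \<forall>\<alpha>::real. \<epsilon> > 0 \<longrightarrow> \<alpha> > 0 \<longrightarrow>
       (\<exists>n0::nat. \<forall>n k :: nat. n \<ge> n0 \<longrightarrow> k > 0 \<longrightarrow> real k < (1/2 - \<alpha>) * real n \<longrightarrow>
          measure_pmf.expectation (pmf_of_set (latin_rectangles k n))
              (\<lambda>L. real (card (latin_subsquares 3 k n L)))
            \<in> {(1 - \<epsilon>) * (real (k choose 3) / (3 * real n ^ 3)) ..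
               (1 + \<epsilon>) * (real (k choose 3) / (3 * real n ^ 3))} \<and>
          measure_pmf.prob (pmf_of_set (latin_rectangles k n))
              {L. \<exists>m>3. latin_subsquares m k n L \<noteq> {}}
            \<le> C / real n ^ 4))"
proof (intro exI[of _ "6 ^ 16 + 2 :: real"] conjI allI impI)
  show "(0::real) < 6 ^ 16 + 2" by simp
  fix \<epsilon> \<alpha> :: real assume eps: "\<epsilon> > 0" and alpha: "\<alpha> > 0"
  define \<delta> where "\<delta> = min \<epsilon> 1"
  have delta: "0 < \<delta>" "\<delta> \<le> 1" "\<delta> \<le> \<epsilon>" using eps by (simp_all add: \<delta>_def)
  obtain \<beta> n1 where beta: "\<beta> > 0"
    and n1: "\<And>n k. n \<ge> n1 \<Longrightarrow> real k < (1/2 - \<alpha>) * n \<Longrightarrow> nearly_uniform_entries k n (\<beta> * n) (\<delta> / 20)"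
    by (rule eventually_nearly_uniform_entries[of "\<delta> / 20" \<alpha>]) (use delta alpha in auto)
  obtain \<gamma> n2 where gamma: "\<gamma> > 0"
    and n2: "\<And>n k. n \<ge> n2 \<Longrightarrow> real k < (1/2 - \<alpha>) * n \<Longrightarrow> nearly_uniform_entries k n (\<gamma> * n) (1 / 2)"
    by (rule eventually_nearly_uniform_entries[of "1 / 2" \<alpha>]) (use alpha in auto)
  \<comment> \<open>The cap 1/12 keeps the orders up to \<open>b\<close> in the range where \<open>(2 m / n) ^ m\<close> decreases.\<close>
  define \<kappa> where "\<kappa> = min \<gamma> (1 / 12)"
  have kappa: "\<kappa> > 0" "\<kappa> \<le> \<gamma>" "\<kappa> \<le> 1 / 12" using gamma by (simp_all add: \<kappa>_def)
  define x where "x = Max {24 / \<delta>, 3 / \<beta>, 8 / \<kappa>, 40 / \<kappa>\<^sup>2}"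
  have x: "24 / \<delta> \<le> x" "3 / \<beta> \<le> x" "8 / \<kappa> \<le> x" "40 / \<kappa>\<^sup>2 \<le> x" by (simp_all add: x_def)
  define n0 where "n0 = max (max n1 n2) (max (10 ^ 15) (nat \<lceil>x\<rceil>))"
  show "\<exists>n0::nat. \<forall>n k :: nat. n \<ge> n0 \<longrightarrow> k > 0 \<longrightarrow> real k < (1/2 - \<alpha>) * real n \<longrightarrow>
          measure_pmf.expectation (pmf_of_set (latin_rectangles k n))
              (\<lambda>L. real (card (latin_subsquares 3 k n L)))
            \<in> {(1 - \<epsilon>) * (real (k choose 3) / (3 * real n ^ 3)) ..
               (1 + \<epsilon>) * (real (k choose 3) / (3 * real n ^ 3))} \<and>
          measure_pmf.prob (pmf_of_set (latin_rectangles k n))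
              {L. \<exists>m>3. latin_subsquares m k n L \<noteq> {}}
            \<le> (6 ^ 16 + 2) / real n ^ 4"
  proof (intro exI[of _ n0] allI impI conjI)
    fix n k :: nat
    assume nn: "n \<ge> n0" and "k > 0" and k: "real k < (1/2 - \<alpha>) * real n"
    have n: "n \<ge> n1" "n \<ge> n2" "10 ^ 15 \<le> n" "nat \<lceil>x\<rceil> \<le> n" using nn by (simp_all add: n0_def)
    have xn: "x \<le> n" using n(4) by linarith
    have npos: "real n > 0" using n(3) by simp
    have kn: "2 * k \<le> n"
    proof -
      have "0 \<le> \<alpha> * n" using alpha by simp
      then have "2 * real k \<le> n" using k by (simp add: left_diff_distrib)
      then show ?thesis by linarith
    qed
    have "3 \<le> \<beta> * n" using order_trans[OF x(2) xn] beta by (simp add: divide_le_eq mult.commute)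
    moreover have "24 / \<delta> \<le> n" using order_trans[OF x(1) xn] .
    ultimately have mem: "measure_pmf.expectation (pmf_of_set (latin_rectangles k n))
            (\<lambda>L. real (card (latin_subsquares 3 k n L)))
          \<in> {(1 - \<delta>) * (real (k choose 3) / (3 * real n ^ 3)) ..
             (1 + \<delta>) * (real (k choose 3) / (3 * real n ^ 3))}"
      using expected_order_3_subsquares_asymp[OF n1[OF n(1) k] delta(1,2)] kn by simp
    have "(1 - \<epsilon>) * (real (k choose 3) / (3 * real n ^ 3)) \<le> (1 - \<delta>) * (real (k choose 3) / (3 * real n ^ 3))"
      "(1 + \<delta>) * (real (k choose 3) / (3 * real n ^ 3)) \<le> (1 + \<epsilon>) * (real (k choose 3) / (3 * real n ^ 3))"
      using delta by (intro mult_right_mono; simp)+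
    with mem show "measure_pmf.expectation (pmf_of_set (latin_rectangles k n))
            (\<lambda>L. real (card (latin_subsquares 3 k n L)))
          \<in> {(1 - \<epsilon>) * (real (k choose 3) / (3 * real n ^ 3)) ..
             (1 + \<epsilon>) * (real (k choose 3) / (3 * real n ^ 3))}"
      unfolding atLeastAtMost_iff by linarith
    define b where "b = nat \<lfloor>\<kappa> * n\<rfloor>"
    have kap8: "8 \<le> \<kappa> * n" using order_trans[OF x(3) xn] kappa by (simp add: divide_le_eq mult.commute)
    then have bb: "real b \<le> \<kappa> * n" "\<kappa> * n / 2 \<le> real b" unfolding b_def by linarith+
    show "measure_pmf.prob (pmf_of_set (latin_rectangles k n))
              {L. \<exists>m>3. latin_subsquares m k n L \<noteq> {}} \<le> (6 ^ 16 + 2) / real n ^ 4"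
    proof (rule prob_large_subsquare[OF n2[OF n(2) k] kn _ _ _ _ n(3)])
      have "\<kappa> * n \<le> \<gamma> * n" using kappa by (intro mult_right_mono) auto
      then show "real b \<le> \<gamma> * n" using bb by linarith
      show "4 \<le> b" using bb kap8 by linarith
      have "\<kappa> * n \<le> 1 / 12 * n" using kappa by (intro mult_right_mono) auto
      then show "12 * b \<le> n" using bb by linarith
      have "40 \<le> real n * \<kappa>\<^sup>2" using order_trans[OF x(4) xn] kappa by (simp add: divide_le_eq)
      then have "40 * real n \<le> real n * \<kappa>\<^sup>2 * real n" using npos by (intro mult_right_mono) auto
      also have "\<dots> = 4 * ((\<kappa> * n / 2) * (\<kappa> * n / 2))" by (simp add: power2_eq_square)
      also have "\<dots> \<le> 4 * (real b * real b)"
        using bb kap8 by (intro mult_left_mono mult_mono) auto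
      finally have "10 * real n \<le> real b * real b" by simp
      then show "10 * n \<le> b * b" by (simp flip: of_nat_mult)
    qed
  qed
qed

end
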